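(* Let $x_1,\ldots,x_n \in \mathbb{R}^p$ and $\mu_* \in \mathbb{R}^p$, and let $S = (s_{jk}) = \frac{1}{n}\sum_{i=1}^n (x_i-\mu_* )(x_i-\mu_* )^{\top}$. Suppose that $S$ has strictly positive diagonal elements and that there is no pair $(j,k)$, $j \neq k$, with $s_{jk} = \sqrt{s_{jj}s_{kk}}$. Let $\widehat{\Omega}$ be the unique minimizer of $-\log\det(\Omega) + \operatorname{tr}(\Omega S)$ over $\Omega \in \overline{\mathcal{M}^p}$. Then the sequence of iterates $(\Omega^t)_{t\geq 0}$ of the cyclic block coordinate descent algorithm described in the context satisfies $$\lim_{t\to\infty} \Omega^t = \widehat{\Omega}.$$
   Context: $\overline{\mathcal{M}^p}$ denotes the set of real symmetric positive semidefinite $p\times p$ matrices $\Omega=(\omega_{jk})$ with $\omega_{jk}\leq 0$ for all $j\neq k$; $-\log\det(\Omega) = +\infty$ if $\Omega$ is not positive definite. Under the stated conditions on $S$ the minimizer $\widehat{\Omega}$ exists and is unique. Block coordinate descent algorithm (run indefinitely, without a stopping criterion). For a symmetric matrix $A \in \mathbb{R}^{p\times p}$ and an index $j$, let $A_{jj}\in\mathbb{R}^{(p-1)\times(p-1)}$ be $A$ with row and column $j$ deleted, let $a_{jj}$ be the $j$-th diagonal entry, and let $a_j \in \mathbb{R}^{p-1}$ be column $j$ without its $j$-th entry. Initialization: $\Omega^0 = D(S)^{-1}$, where $D(S)$ is the diagonal matrix with the diagonal entries of $S$. The algorithm cycles repeatedly through $j = 1,\ldots,p$; at each step, with current iterate $\Omega^t$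 and current index $j$, let $\widetilde{\Omega}^t(\omega_{jj},\omega_j)$ denote the symmetric matrix obtained from $\Omega^t$ by replacing its $(j,j)$ entry by $\omega_{jj} \in \mathbb{R}$ and the remaining entries of its $j$-th column and row by $\omega_j \in \mathbb{R}^{p-1}$ (the submatrix $\Omega^t_{jj}$ being kept fixed), compute the unique solution $$(\widetilde{\omega}_{jj},\widetilde{\omega}_j) = \operatorname*{argmin}_{\omega_{jj},\,\omega_j}\; -\log\det \widetilde{\Omega}^t(\omega_{jj},\omega_j) + \operatorname{tr}\big(\widetilde{\Omega}^t(\omega_{jj},\omega_j) S\big) \quad \text{subject to } \omega_j \leq 0 \text{ (componentwise)},\ \widetilde{\Omega}^t(\omega_{jj},\omega_j) \text{ positive semidefinite},$$ set $\Omega^{t+1} = \widetilde{\Omega}^t(\widetilde{\omega}_{jj},\widetilde{\omega}_j)$, increase $t$ by one, and move on to the next index (returning to $j=1$ after $j = p$). All iterates are positive definite. *)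

theory Defs
  imports "HOL-Analysis.Analysis"
begin

definition outer_prod :: "real ^ 'p \<Rightarrow> real ^ 'p \<Rightarrow> real ^ 'p ^ 'p" where
  "outer_prod u v = (\<chi> j k. u $ j * v $ k)"

definition sample_second_moment :: "nat \<Rightarrow> (nat \<Rightarrow> real ^ 'p) \<Rightarrow> real ^ 'p \<Rightarrow> real ^ 'p ^ 'p" where
  "sample_second_moment n x \<mu> = (1 / real n) *\<^sub>R (\<Sum>i=1..n. outer_prod (x i - \<mu>) (x i - \<mu>))"

definition pos_semidef :: "real ^ 'p ^ 'p \<Rightarrow> bool" where
  "pos_semidef A \<longleftrightarrow> transpose A = A \<and> (\<forall>v. 0 \<le> v \<bullet> (A *v v))"

definition pos_def :: "real ^ 'p ^ 'p \<Rightarrow> bool" where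
  "pos_def A \<longleftrightarrow> transpose A = A \<and> (\<forall>v. v \<noteq> 0 \<longrightarrow> 0 < v \<bullet> (A *v v))"

definition M_closed :: "(real ^ 'p ^ 'p) set" where
  "M_closed = {\<Omega>. pos_semidef \<Omega> \<and> (\<forall>j k. j \<noteq> k \<longrightarrow> \<Omega> $ j $ k \<le> 0)}"

definition neg_log_det :: "real ^ 'p ^ 'p \<Rightarrow> ereal" where
  "neg_log_det \<Omega> = (if pos_def \<Omega> then ereal (- ln (det \<Omega>)) else \<infinity>)"

definition objective :: "real ^ 'p ^ 'p \<Rightarrow> real ^ 'p ^ 'p \<Rightarrow> ereal" where
  "objective S \<Omega> = neg_log_det \<Omega> + ereal (trace (\<Omega> ** S))"

definition estimator :: "real ^ 'p ^ 'p \<Rightarrow> real ^ 'p ^ 'p" where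
  "estimator S = (THE \<Omega>. is_arg_min (objective S) (\<lambda>\<Omega>. \<Omega> \<in> M_closed) \<Omega>)"

definition diag_part :: "real ^ 'p ^ 'p \<Rightarrow> real ^ 'p ^ 'p" where
  "diag_part A = (\<chi> j k. if j = k then A $ j $ k else 0)"

(* A block (w_jj, w_j) in R x R^(p-1) is encoded as a single vector w in R^p:
   w $ j is the new diagonal entry, the remaining components form w_j. *)
definition replace_row_col :: "real ^ 'p ^ 'p \<Rightarrow> 'p \<Rightarrow> real ^ 'p \<Rightarrow> real ^ 'p ^ 'p" where
  "replace_row_col \<Omega> j w =
     (\<chi> a b. if a = j then w $ b else if b = j then w $ a else \<Omega> $ a $ b)"

definition block_feasible :: "real ^ 'p ^ 'p \<Rightarrow> 'p \<Rightarrow> real ^ 'p \<Rightarrow> bool" where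
  "block_feasible \<Omega> j w \<longleftrightarrow> (\<forall>k. k \<noteq> j \<longrightarrow> w $ k \<le> 0) \<and> pos_semidef (replace_row_col \<Omega> j w)"

definition block_argmin :: "real ^ 'p ^ 'p \<Rightarrow> real ^ 'p ^ 'p \<Rightarrow> 'p \<Rightarrow> real ^ 'p" where
  "block_argmin S \<Omega> j =
     (THE w. is_arg_min (\<lambda>w. objective S (replace_row_col \<Omega> j w)) (block_feasible \<Omega> j) w)"

(* idx 0, ..., idx (CARD('p) - 1) is the order in which the p coordinates are cycled through. *)
primrec bcd_iterate :: "(nat \<Rightarrow> 'p) \<Rightarrow> real ^ 'p ^ 'p \<Rightarrow> nat \<Rightarrow> real ^ 'p ^ 'p" where
  "bcd_iterate idx S 0 = matrix_inv (diag_part S)"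
| "bcd_iterate idx S (Suc t) =
     (let \<Omega> = bcd_iterate idx S t; j = idx (t mod CARD('p))
      in replace_row_col \<Omega> j (block_argmin S \<Omega> j))"

end

theory Submission
  imports Defs
begin

text \<open>Write \<open>F \<Omega> = tr (\<Omega> S) - ln (det \<Omega>)\<close> for the objective on positive definite matrices.
Three facts drive the proof.

\<^emph>\<open>Strict convexity.\<close> The function \<open>F\<close> lies above its tangents, strictly so away from the point of
tangency; the gradient at \<open>B\<close> is \<open>S - B\<inverse>\<close> (\<open>finite_objective_tangent\<close>). A simultaneous
diagonalization of two positive definite matrices by congruence reduces this to \<open>ln x \<le> x - 1\<close> for
the generalized eigenvalues.

\<^emph>\<open>Compactness.\<close> The sublevel sets of \<open>F\<close> within the sign-constrained cone are compact
(\<open>compact_sublevel\<close>), although \<open>S\<close> may be singular. The reason is that off-diagonal entries of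
\<open>\<Omega>\<close> are nonpositive, so raising an off-diagonal entry of \<open>S\<close> can only decrease \<open>tr (\<Omega> S)\<close>. As
no correlation equals 1, these entries can be raised until all correlations have one common value
\<open>\<rho> < 1\<close>; the resulting matrix is positive definite, so \<open>tr (\<Omega> S)\<close> dominates a multiple of
\<open>tr \<Omega>\<close>. Together with strict convexity, this makes every minimization that occurs, over the whole
cone or over one block, uniquely solvable.

\<^emph>\<open>Blockwise optimality is global optimality.\<close> The sign constraints bound each entry separately and
\<open>F\<close> is differentiable, so a direction \<open>\<Omega> - A\<close> splits into feasible directions that each live in one
row and column, and the first-order conditions add up (\<open>blockwise_optimal_imp_optimal\<close>).

Convergence then follows from the descent of \<open>F\<close>. A block step that moves by at least \<open>e\<close> decreases
\<open>F\<close> by at least some \<open>\<delta> > 0\<close>, because the midpoint of the step belongs to the block and \<open>F\<close> is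
strictly convex on a compact set. Since \<open>F\<close> is bounded below along the iterates, the steps tend to 0.
Hence along a convergent subsequence all iterates of the next cycle have the same limit, and this
limit inherits optimality in every block. So it is the minimizer, and by compactness the whole
sequence converges to it.\<close>

section \<open>Forms of symmetric and positive definite matrices\<close>

lemma symmetric_form_commute:
  fixes A :: "real^'n^'n"
  assumes "transpose A = A"
  shows "u \<bullet> (A *v w) = w \<bullet> (A *v u)"
  by (metis assms dot_lmul_matrix inner_commute transpose_matrix_vector)

lemma symmetric_form_expand:
  fixes A :: "real^'n^'n"
  assumes "transpose A = A"
  shows "(v + s *\<^sub>R w) \<bullet> (A *v (v + s *\<^sub>R w))
         = v \<bullet> (A *v v) + 2 * s * (w \<bullet> (A *v v)) + s\<^sup>2 * (w \<bullet> (A *v w))"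
  using symmetric_form_commute[OF assms, of v w]
  by (simp add: matrix_vector_right_distrib matrix_vector_mult_scaleR inner_add_left inner_add_right
      power2_eq_square algebra_simps)

lemma form_scaleR:
  fixes A :: "real^'n^'n"
  shows "(r *\<^sub>R v) \<bullet> (A *v (r *\<^sub>R v)) = r * r * (v \<bullet> (A *v v))"
  by (simp add: matrix_vector_mult_scaleR)

lemma nonneg_quadratic_imp_linear_zero:
  fixes b c :: real
  assumes "\<And>s. 0 \<le> 2 * s * b + s\<^sup>2 * c"
  shows "b = 0"
proof (rule ccontr)
  assume b: "b \<noteq> 0"
  define d where "d = \<bar>c\<bar> + 1"
  have d: "d > 0" "c < d" unfolding d_def by auto
  \<comment> \<open>With \<open>d > c\<close> in place of \<open>c\<close>, the quadratic has its minimum at \<open>- b / d\<close>.\<close>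
  have "0 \<le> 2 * (- b / d) * b + (- b / d)\<^sup>2 * c" by (rule assms)
  also have "\<dots> \<le> 2 * (- b / d) * b + (- b / d)\<^sup>2 * d"
    using d by (intro add_left_mono mult_left_mono) auto
  also have "\<dots> = - (b\<^sup>2 / d)" using d by (simp add: power2_eq_square field_simps)
  also have "\<dots> < 0" using b d by simp
  finally show False by simp
qed

text \<open>A zero of a nonnegative form is a minimum of it, so the derivative of the form vanishes there in
every direction of the subspace.\<close>
lemma null_vector_of_nonneg_form:
  fixes A :: "real^'n^'n"
  assumes A: "transpose A = A" and W: "subspace W" "t \<in> W" "w \<in> W"
    and nonneg: "\<And>v. v \<in> W \<Longrightarrow> 0 \<le> v \<bullet> (A *v v)" and null: "t \<bullet> (A *v t) = 0"
  shows "w \<bullet> (A *v t) = 0"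
proof (rule nonneg_quadratic_imp_linear_zero)
  fix s :: real
  have "t + s *\<^sub>R w \<in> W" using W by (intro subspace_add subspace_scale)
  from nonneg[OF this]
  show "0 \<le> 2 * s * (w \<bullet> (A *v t)) + s\<^sup>2 * (w \<bullet> (A *v w))"
    using null by (simp add: symmetric_form_expand[OF A])
qed

lemma continuous_on_form:
  fixes A :: "real^'n^'n"
  shows "continuous_on X (\<lambda>v. v \<bullet> (A *v v))"
  by (intro continuous_intros linear_continuous_on_compose matrix_vector_mul_linear)

lemma pos_def_coercive:
  fixes A :: "real^'n^'n"
  assumes "pos_def A"
  obtains m where "m > 0" "\<And>v. m * (norm v)\<^sup>2 \<le> v \<bullet> (A *v v)"
proof -
  have ne: "sphere (0::real^'n) 1 \<noteq> {}" by simp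
  obtain u where u: "u \<in> sphere (0::real^'n) 1"
    and min: "\<And>v. v \<in> sphere 0 1 \<Longrightarrow> u \<bullet> (A *v u) \<le> v \<bullet> (A *v v)"
    using continuous_attains_inf[OF compact_sphere ne continuous_on_form[of _ A]] by blast
  have "u \<bullet> (A *v u) > 0" using assms u unfolding pos_def_def
    by (metis dist_0_norm mem_sphere norm_zero zero_neq_one)
  moreover have "(u \<bullet> (A *v u)) * (norm v)\<^sup>2 \<le> v \<bullet> (A *v v)" for v
  proof (cases "v = 0")
    case False
    have "u \<bullet> (A *v u) \<le> (v /\<^sub>R norm v) \<bullet> (A *v (v /\<^sub>R norm v))"
      using False by (intro min) simp
    also have "\<dots> = v \<bullet> (A *v v) / (norm v)\<^sup>2"
      by (simp add: matrix_vector_mult_scaleR power2_eq_square divide_inverse)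
    finally show ?thesis using False by (simp add: field_simps)
  qed simp
  ultimately show thesis using that by blast
qed

text \<open>This lets sublevel sets be described by closed conditions: positive definiteness is not closed, but
positive semidefiniteness together with a positive lower bound on the determinant is.\<close>
lemma pos_semidef_det_nonzero_imp_pos_def:
  fixes A :: "real^'n^'n"
  assumes "pos_semidef A" "det A \<noteq> 0"
  shows "pos_def A"
proof -
  have sym: "transpose A = A" and nonneg: "\<And>v. 0 \<le> v \<bullet> (A *v v)"
    using assms(1) by (auto simp: pos_semidef_def)
  have "v = 0" if "v \<bullet> (A *v v) = 0" for v
  proof -
    have "w \<bullet> (A *v v) = 0" for w
      using null_vector_of_nonneg_form[OF sym subspace_UNIV] nonneg that by blast
    then have "A *v v = 0" by (metis inner_eq_zero_iff)
    then show "v = 0"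
      using assms(2) by (metis invertible_det_nz invertible_left_inverse matrix_left_invertible_ker)
  qed
  then show ?thesis using sym nonneg unfolding pos_def_def by (auto simp: less_le)
qed

lemma pos_def_imp_pos_semidef: "pos_def A \<Longrightarrow> pos_semidef A"
  unfolding pos_def_def pos_semidef_def
  by (metis inner_zero_left order.order_iff_strict)

section \<open>Simultaneous diagonalization by congruence\<close>

text \<open>The Rayleigh argument for the generalized eigenproblem \<open>A t = l B t\<close> on a subspace: at a maximizer
\<open>t\<close> of \<open>v \<bullet> A v\<close> subject to \<open>v \<bullet> B v = 1\<close>, the form of \<open>l B - A\<close> is nonnegative and vanishes.\<close>
lemma simultaneous_diagonal_step:
  fixes A B :: "real^'n^'n"
  assumes A: "transpose A = A" and B: "pos_def B" and W: "subspace W" "W \<noteq> {0}"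
  obtains t l where "t \<in> W" "t \<bullet> (B *v t) = 1" "\<And>w. w \<in> W \<Longrightarrow> w \<bullet> (A *v t) = l * (w \<bullet> (B *v t))"
proof -
  obtain m where m: "m > 0" "\<And>v. m * (norm v)\<^sup>2 \<le> v \<bullet> (B *v v)"
    using pos_def_coercive[OF B] by blast
  define K where "K = {v \<in> W. v \<bullet> (B *v v) = 1}"
  have "bounded K"
  proof (rule boundedI)
    fix v assume "v \<in> K"
    then have "(norm v)\<^sup>2 \<le> 1 / m" using m(2)[of v] m(1) by (simp add: K_def field_simps)
    then show "norm v \<le> sqrt (1 / m)" by (simp add: real_le_rsqrt)
  qed
  moreover have "closed K"
  proof -
    have "K = W \<inter> (\<lambda>v. v \<bullet> (B *v v)) -` {1}" unfolding K_def by auto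
    moreover have "closed ((\<lambda>v. v \<bullet> (B *v v)) -` {1})"
      using continuous_closed_vimage[OF closed_singleton, of "\<lambda>v. v \<bullet> (B *v v)" "1"]
        continuous_on_form[of UNIV B] by (simp add: continuous_on_eq_continuous_at)
    ultimately show ?thesis using W(1) closed_subspace by auto
  qed
  ultimately have "compact K" by (simp add: compact_eq_bounded_closed)
  have normalise: "\<exists>r. r \<noteq> 0 \<and> r *\<^sub>R v \<in> K" if "v \<in> W" "v \<noteq> 0" for v
  proof -
    have p: "v \<bullet> (B *v v) > 0" using B that by (auto simp: pos_def_def)
    define r where "r = 1 / sqrt (v \<bullet> (B *v v))"
    have "r * r * (v \<bullet> (B *v v)) = 1" using p unfolding r_def by simp
    then have "r *\<^sub>R v \<in> K"
      using that W(1) by (simp add: K_def subspace_scale matrix_vector_mult_scaleR)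
    then show ?thesis using p unfolding r_def by (intro exI[of _ r]) (auto simp: r_def)
  qed
  obtain v where "v \<in> W" "v \<noteq> 0" using W subspace_0 by blast
  then have "K \<noteq> {}" using normalise by blast
  then obtain t where t: "t \<in> K" and max: "\<And>v. v \<in> K \<Longrightarrow> v \<bullet> (A *v v) \<le> t \<bullet> (A *v t)"
    using continuous_attains_sup[OF \<open>compact K\<close> _ continuous_on_form[of K A]] by blast
  define l where "l = t \<bullet> (A *v t)"
  define Q where "Q = l *\<^sub>R B - A"
  have Bsym: "transpose B = B" using B by (simp add: pos_def_def)
  have Qsym: "transpose Q = Q"
    using A Bsym unfolding Q_def by (simp add: transpose_def vec_eq_iff)
  have Qv: "Q *v v = l *\<^sub>R (B *v v) - A *v v" for v
    unfolding Q_def by (simp add: matrix_vector_mult_diff_rdistrib scaleR_matrix_vector_assoc)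
  have "0 \<le> v \<bullet> (Q *v v)" if v: "v \<in> W" for v
  proof (cases "v = 0")
    case False
    then obtain r where r: "r \<noteq> 0" "r *\<^sub>R v \<in> K" using normalise[OF v] by blast
    have "r * r * (v \<bullet> (A *v v)) \<le> l"
      using max[OF r(2)] unfolding form_scaleR l_def .
    moreover have "r * r * (v \<bullet> (B *v v)) = 1"
      using r(2) unfolding K_def mem_Collect_eq form_scaleR by blast
    moreover have "r * r * (v \<bullet> (Q *v v)) = l * (r * r * (v \<bullet> (B *v v))) - r * r * (v \<bullet> (A *v v))"
      unfolding Qv inner_diff_right inner_scaleR_right by (simp only: right_diff_distrib mult.left_commute)
    ultimately have "0 \<le> r * r * (v \<bullet> (Q *v v))" by simp
    moreover have "r * r > 0" using r(1) by (auto simp: zero_less_mult_iff)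
    ultimately show ?thesis by (simp add: zero_le_mult_iff)
  qed simp
  moreover have "t \<bullet> (Q *v t) = 0" using t by (simp add: Qv inner_diff_right l_def K_def)
  ultimately have "w \<bullet> (Q *v t) = 0" if "w \<in> W" for w
    using null_vector_of_nonneg_form[OF Qsym W(1), of t w] t that by (simp add: K_def)
  then show thesis
    using t by (intro that[of t l]) (auto simp: Qv inner_diff_right K_def)
qed

text \<open>Each new vector is taken from the \<open>B\<close>-orthogonal complement of the earlier ones. The eigenvalue
relation for \<open>t i\<close> is stated only against vectors \<open>v\<close> that are \<open>B\<close>-orthogonal to the earlier
vectors, which is what the maximization on that complement yields; the later vectors
are such \<open>v\<close>, so the relation suffices for \<open>A\<close>-orthogonality of the family.\<close>
lemma simultaneous_diagonal_family:
  fixes A B :: "real^'n^'n"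
  assumes A: "transpose A = A" and B: "pos_def B" and "m \<le> CARD('n)"
  shows "\<exists>(t::nat \<Rightarrow> real^'n) l. (\<forall>i<m. \<forall>k<m. t i \<bullet> (B *v t k) = (if i = k then 1 else 0))
           \<and> (\<forall>i<m. \<forall>v. (\<forall>k<i. v \<bullet> (B *v t k) = 0) \<longrightarrow> v \<bullet> (A *v t i) = l i * (v \<bullet> (B *v t i)))"
  using \<open>m \<le> CARD('n)\<close>
proof (induction m)
  case (Suc m)
  then have "m \<le> CARD('n)" by simp
  from Suc.IH[OF this] obtain t :: "nat \<Rightarrow> real^'n" and l where
    orth_all: "\<forall>i<m. \<forall>k<m. t i \<bullet> (B *v t k) = (if i = k then 1 else 0)" and
    eig_all: "\<forall>i<m. \<forall>v. (\<forall>k<i. v \<bullet> (B *v t k) = 0) \<longrightarrow> v \<bullet> (A *v t i) = l i * (v \<bullet> (B *v t i))"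
    by (elim exE conjE)
  note orth = orth_all[rule_format] and eig = eig_all[rule_format]
  have Bsym: "transpose B = B" using B by (simp add: pos_def_def)
  define W where "W = {v. \<forall>k<m. v \<bullet> (B *v t k) = 0}"
  have W: "subspace W" unfolding W_def subspace_def by (auto simp: inner_add_left)
  have "W \<noteq> {0}"
  proof -
    have "dim ((\<lambda>k. B *v t k) ` {..<m}) \<le> card ((\<lambda>k. B *v t k) ` {..<m})"
      by (intro dim_le_card') simp
    also have "\<dots> \<le> m" using card_image_le[of "{..<m}" "\<lambda>k. B *v t k"] by simp
    also have "\<dots> < DIM(real^'n)" using Suc.prems by simp
    finally obtain x where x: "x \<noteq> 0" "\<And>y. y \<in> span ((\<lambda>k. B *v t k) ` {..<m}) \<Longrightarrow> orthogonal x y"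
      using orthogonal_to_subspace_exists by blast
    have "x \<in> W" unfolding W_def using x(2) by (auto simp: orthogonal_def intro!: span_base)
    then show ?thesis using x(1) by blast
  qed
  from simultaneous_diagonal_step[OF A B W this] obtain s c where
    s: "s \<in> W" "s \<bullet> (B *v s) = 1" "\<And>w. w \<in> W \<Longrightarrow> w \<bullet> (A *v s) = c * (w \<bullet> (B *v s))" by metis
  have s0: "s \<bullet> (B *v t k) = 0" "t k \<bullet> (B *v s) = 0" if "k < m" for k
    using s(1) that symmetric_form_commute[OF Bsym, of s "t k"] by (auto simp: W_def)
  show ?case
  proof (intro exI conjI allI impI)
    fix i k assume "i < Suc m" "k < Suc m"
    then show "(t(m := s)) i \<bullet> (B *v (t(m := s)) k) = (if i = k then 1 else 0)"
      using orth s0 s(2) by (auto simp: less_Suc_eq)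
  next
    fix i v assume i: "i < Suc m" and v: "\<forall>k<i. v \<bullet> (B *v (t(m := s)) k) = 0"
    show "v \<bullet> (A *v (t(m := s)) i) = (l(m := c)) i * (v \<bullet> (B *v (t(m := s)) i))"
    proof (cases "i = m")
      case True
      have "v \<in> W" unfolding W_def using v True by (auto split: if_splits)
      then show ?thesis using s(3) True by simp
    next
      case False
      then have "i < m" using i by simp
      then have "\<And>k. k < i \<Longrightarrow> v \<bullet> (B *v t k) = 0" using v by (auto split: if_splits)
      then show ?thesis using eig[OF \<open>i < m\<close>] False by simp
    qed
  qed
qed simp

lemma congruence_entry:
  fixes T B :: "real^'n^'n"
  shows "(transpose T ** B ** T) $ i $ j = column i T \<bullet> (B *v column j T)"
  unfolding matrix_mul_assoc[symmetric]
  by (simp add: matrix_matrix_mult_def transpose_def inner_vec_def column_def matrix_vector_mult_def)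

lemma simultaneous_diagonalization:
  fixes A B :: "real^'n^'n"
  assumes A: "transpose A = A" and B: "pos_def B"
  obtains T :: "real^'n^'n" and l :: "'n \<Rightarrow> real"
    where "transpose T ** B ** T = mat 1"
      and "transpose T ** A ** T = (\<chi> i j. if i = j then l i else 0)"
proof -
  obtain t :: "nat \<Rightarrow> real^'n" and c where
    orth_all: "\<forall>i<CARD('n). \<forall>k<CARD('n). t i \<bullet> (B *v t k) = (if i = k then 1 else 0)" and
    eig_all: "\<forall>i<CARD('n). \<forall>v. (\<forall>k<i. v \<bullet> (B *v t k) = 0) \<longrightarrow>
                v \<bullet> (A *v t i) = c i * (v \<bullet> (B *v t i))"
    using simultaneous_diagonal_family[OF A B order.refl] by (elim exE conjE)
  note orth = orth_all[rule_format] and eig = eig_all[rule_format]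
  have A_diag: "t k \<bullet> (A *v t i) = (if k = i then c i else 0)"
    if "i \<le> k" "k < CARD('n)" for i k
  proof -
    have "t k \<bullet> (A *v t i) = c i * (t k \<bullet> (B *v t i))"
      using that by (intro eig) (auto simp: orth)
    then show ?thesis using that by (simp add: orth)
  qed
  have A_diag': "t k \<bullet> (A *v t i) = (if k = i then c i else 0)"
    if "i < CARD('n)" "k < CARD('n)" for i k
    using A_diag[of i k] A_diag[of k i] symmetric_form_commute[OF A, of "t k" "t i"] that
    by (cases "i \<le> k") auto
  obtain h :: "'n \<Rightarrow> nat" where h: "bij_betw h UNIV {..<CARD('n)}"
    using ex_bij_betw_finite_nat[of "UNIV::'n set"] by (auto simp: atLeast0LessThan)
  then have h_less: "h i < CARD('n)" and h_inj: "h i = h j \<longleftrightarrow> i = j" for i j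
    by (auto simp: bij_betw_def inj_def)
  define T :: "real^'n^'n" where "T = (\<chi> a i. t (h i) $ a)"
  have col: "column i T = t (h i)" for i
    by (simp add: T_def column_def vec_eq_iff)
  show thesis
  proof (rule that[of T "\<lambda>i. c (h i)"])
    show "transpose T ** B ** T = mat 1"
      by (simp add: vec_eq_iff congruence_entry col orth h_less h_inj mat_def)
    show "transpose T ** A ** T = (\<chi> i j. if i = j then c (h i) else 0)"
      by (simp add: vec_eq_iff congruence_entry col A_diag' h_less h_inj)
  qed
qed

section \<open>Strict convexity of the objective\<close>

lemma matrix_inv_eqI:
  fixes A X :: "real^'n^'n"
  assumes "A ** X = mat 1"
  shows "matrix_inv A = X"
proof -
  have XA: "X ** A = mat 1" using assms by (simp add: matrix_left_right_inverse)
  have "A ** matrix_inv A = mat 1 \<and> matrix_inv A ** A = mat 1"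
    unfolding matrix_inv_def by (rule someI[of _ X]) (use assms XA in blast)
  then show ?thesis
    using XA by (metis matrix_mul_assoc matrix_mul_lid matrix_mul_rid)
qed

lemma matrix_inv_right:
  fixes A :: "real^'n^'n"
  assumes "det A \<noteq> 0"
  shows "A ** matrix_inv A = mat 1"
  using assms matrix_inv_eqI by (metis invertible_det_nz invertible_def)

lemma pos_def_det_pos:
  fixes A :: "real^'n^'n"
  assumes A: "pos_def A"
  shows "det A > 0"
proof -
  have "transpose A = A" using A by (simp add: pos_def_def)
  then obtain T :: "real^'n^'n" where T: "transpose T ** A ** T = mat 1"
    using simultaneous_diagonalization[OF _ A] by metis
  have eq: "(det T)\<^sup>2 * det A = 1"
    using arg_cong[OF T, of det] by (simp add: det_mul power2_eq_square mult_ac)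
  then have "det T \<noteq> 0" by auto
  then show ?thesis using eq by (metis zero_less_mult_pos zero_less_one zero_less_power2)
qed

text \<open>If \<open>T\<close> turns \<open>B\<close> into the identity and \<open>A\<close> into a diagonal matrix with entries \<open>l i > 0\<close>, then
\<open>B\<inverse> = T T\<^sup>T\<close>, so the trace is the sum of the \<open>l i\<close>, while \<open>ln (det A) - ln (det B)\<close> is the sum
of the \<open>ln (l i)\<close>. The claim is \<open>ln x \<le> x - 1\<close>, with equality for \<open>x = 1\<close> only.\<close>
lemma log_det_tangent:
  fixes A B :: "real^'n^'n"
  assumes A: "pos_def A" and B: "pos_def B"
  shows "ln (det A) \<le> ln (det B) + trace (matrix_inv B ** A) - real CARD('n)"
    and "A \<noteq> B \<Longrightarrow> ln (det A) < ln (det B) + trace (matrix_inv B ** A) - real CARD('n)"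
proof -
  have "transpose A = A" using A by (simp add: pos_def_def)
  then obtain T :: "real^'n^'n" and l :: "'n \<Rightarrow> real" where
    TB: "transpose T ** B ** T = mat 1" and
    TA: "transpose T ** A ** T = (\<chi> i j. if i = j then l i else 0)"
    using simultaneous_diagonalization[OF _ B] by blast
  have detB: "(det T)\<^sup>2 * det B = 1"
    using arg_cong[OF TB, of det] by (simp add: det_mul power2_eq_square mult_ac)
  then have T0: "det T \<noteq> 0" by auto
  have detA: "(det T)\<^sup>2 * det A = (\<Prod>i\<in>UNIV. l i)"
    using arg_cong[OF TA, of det] det_diagonal[of "\<chi> i j. if i = j then l i else 0"]
    by (simp add: det_mul power2_eq_square mult_ac)
  have l_pos: "l i > 0" for i
  proof -
    have "column i T = T *v axis i 1" by (simp add: matrix_vector_mul_component matrix_vector_mult_basis)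
    moreover have "T *v axis i 1 \<noteq> 0"
      using T0 by (metis axis_eq_0_iff invertible_det_nz invertible_left_inverse
          matrix_left_invertible_ker zero_neq_one)
    ultimately have "column i T \<bullet> (A *v column i T) > 0"
      using A by (simp add: pos_def_def)
    then show ?thesis using TA congruence_entry[of T A i i] by simp
  qed
  have A_pos: "det A > 0" using A by (rule pos_def_det_pos)
  have "T ** (transpose T ** B) = mat 1" using TB by (simp add: matrix_left_right_inverse)
  then have "(T ** transpose T) ** B = mat 1" by (simp add: matrix_mul_assoc)
  then have BTT: "B ** (T ** transpose T) = mat 1" by (simp add: matrix_left_right_inverse)
  then have inv: "matrix_inv B = T ** transpose T" by (rule matrix_inv_eqI)
  have "trace (matrix_inv B ** A) = trace (T ** (transpose T ** A))"
    by (simp add: inv matrix_mul_assoc)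
  also have "\<dots> = trace (transpose T ** A ** T)" by (rule trace_mul_sym)
  also have "\<dots> = (\<Sum>i\<in>UNIV. l i)" by (simp add: TA trace_def)
  finally have tr: "trace (matrix_inv B ** A) = (\<Sum>i\<in>UNIV. l i)" .
  have "ln (det A) = ln (\<Prod>i\<in>UNIV. l i) - ln ((det T)\<^sup>2)"
    unfolding detA[symmetric] using A_pos T0 by (simp add: ln_mult)
  also have "(det T)\<^sup>2 = inverse (det B)"
    using detB by (intro inverse_unique[symmetric]) (simp add: mult.commute)
  also have "ln (inverse (det B)) = - ln (det B)" by (rule ln_inverse)
  also have "ln (\<Prod>i\<in>UNIV. l i) = (\<Sum>i\<in>UNIV. ln (l i))"
    using l_pos by (intro ln_prod) (simp_all add: less_imp_neq[symmetric])
  finally have lnA: "ln (det A) = ln (det B) + (\<Sum>i\<in>UNIV. ln (l i))" by simp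
  have tr': "trace (matrix_inv B ** A) - real CARD('n) = (\<Sum>i\<in>UNIV. l i - 1)"
    by (simp add: tr sum_subtractf)
  have "(\<Sum>i\<in>UNIV. ln (l i)) \<le> (\<Sum>i\<in>UNIV. l i - 1)"
    by (intro sum_mono ln_le_minus_one l_pos)
  then show "ln (det A) \<le> ln (det B) + trace (matrix_inv B ** A) - real CARD('n)"
    using lnA tr' by simp
  show "ln (det A) < ln (det B) + trace (matrix_inv B ** A) - real CARD('n)" if "A \<noteq> B"
  proof -
    have "\<exists>i. l i \<noteq> 1"
    proof (rule ccontr)
      assume "\<nexists>i. l i \<noteq> 1"
      then have "transpose T ** A ** T = transpose T ** B ** T"
        using TA TB by (simp add: mat_def vec_eq_iff)
      moreover have "invertible T" "invertible (transpose T)"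
        using T0 by (simp_all add: invertible_det_nz)
      then obtain P Q where "T ** P = mat 1" "Q ** transpose T = mat 1"
        unfolding invertible_def by blast
      then have "X = Q ** (transpose T ** X ** T) ** P" for X
        by (simp add: matrix_mul_assoc) (simp add: matrix_mul_assoc[symmetric])
      ultimately have "A = B" by metis
      with that show False by simp
    qed
    then obtain i where "l i \<noteq> 1" by blast
    then have "ln (l i) < l i - 1"
      using ln_le_minus_one[OF l_pos[of i]] ln_eq_minus_one[OF l_pos[of i]] by force
    then have "(\<Sum>i\<in>UNIV. ln (l i)) < (\<Sum>i\<in>UNIV. l i - 1)"
      by (intro sum_strict_mono_ex1) (auto intro: ln_le_minus_one l_pos)
    then show ?thesis using lnA tr' by simp
  qed
qed

text \<open>The real-valued objective. Off the positive definite matrices, where the objective is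
infinite, its value has no meaning.\<close>
definition finite_objective :: "real^'n^'n \<Rightarrow> real^'n^'n \<Rightarrow> real" where
  "finite_objective S \<Omega> = trace (\<Omega> ** S) - ln (det \<Omega>)"

lemma objective_pos_def: "pos_def \<Omega> \<Longrightarrow> objective S \<Omega> = ereal (finite_objective S \<Omega>)"
  by (simp add: objective_def neg_log_det_def finite_objective_def)

lemma objective_not_pos_def: "\<not> pos_def \<Omega> \<Longrightarrow> objective S \<Omega> = \<infinity>"
  by (simp add: objective_def neg_log_det_def)

lemma trace_mult_linear:
  fixes G :: "real^'n^'n"
  shows "linear (\<lambda>A. trace (A ** G))"
  by (rule linearI)
    (simp_all add: trace_def matrix_matrix_mult_def sum.distrib sum_distrib_left algebra_simps)

lemma trace_diff_mult:
  fixes A B G :: "real^'n^'n"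
  shows "trace ((A - B) ** G) = trace (A ** G) - trace (B ** G)"
  by (rule linear_diff[OF trace_mult_linear])

lemma finite_objective_tangent:
  fixes A B S :: "real^'n^'n"
  assumes A: "pos_def A" and B: "pos_def B"
  shows "finite_objective S B + trace ((A - B) ** (S - matrix_inv B)) \<le> finite_objective S A"
    and "A \<noteq> B \<Longrightarrow>
      finite_objective S B + trace ((A - B) ** (S - matrix_inv B)) < finite_objective S A"
proof -
  have "trace ((A - B) ** (S - matrix_inv B))
      = trace ((S - matrix_inv B) ** (A - B))" by (rule trace_mul_sym)
  also have "\<dots> = trace (S ** (A - B)) - trace (matrix_inv B ** (A - B))" by (rule trace_diff_mult)
  also have "trace (matrix_inv B ** (A - B)) = trace ((A - B) ** matrix_inv B)" by (rule trace_mul_sym)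
  also have "\<dots> = trace (A ** matrix_inv B) - trace (mat 1 :: real^'n^'n)"
    using pos_def_det_pos[OF B] by (simp add: trace_diff_mult matrix_inv_right)
  also have "trace (A ** matrix_inv B) = trace (matrix_inv B ** A)" by (rule trace_mul_sym)
  also have "trace (S ** (A - B)) = trace ((A - B) ** S)" by (rule trace_mul_sym)
  also have "\<dots> = trace (A ** S) - trace (B ** S)" by (rule trace_diff_mult)
  finally have eq: "trace ((A - B) ** (S - matrix_inv B))
      = trace (A ** S) - trace (B ** S) - trace (matrix_inv B ** A) + real CARD('n)"
    by (simp add: trace_I)
  show "finite_objective S B + trace ((A - B) ** (S - matrix_inv B)) \<le> finite_objective S A"
    using log_det_tangent(1)[OF A B] unfolding finite_objective_def eq by simp
  show "finite_objective S B + trace ((A - B) ** (S - matrix_inv B)) < finite_objective S A"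
    if "A \<noteq> B"
    using log_det_tangent(2)[OF A B that] unfolding finite_objective_def eq by simp
qed

lemma pos_def_convex_combination:
  fixes A B :: "real^'n^'n"
  assumes "pos_def A" "pos_semidef B" "0 < a" "0 \<le> b"
  shows "pos_def (a *\<^sub>R A + b *\<^sub>R B)"
proof -
  have "transpose (a *\<^sub>R A + b *\<^sub>R B) = a *\<^sub>R A + b *\<^sub>R B"
    using assms(1,2) by (simp add: pos_def_def pos_semidef_def transpose_def vec_eq_iff)
  moreover have "0 < v \<bullet> ((a *\<^sub>R A + b *\<^sub>R B) *v v)" if "v \<noteq> 0" for v
  proof -
    have "v \<bullet> ((a *\<^sub>R A + b *\<^sub>R B) *v v) = a * (v \<bullet> (A *v v)) + b * (v \<bullet> (B *v v))"
      by (simp add: matrix_vector_mult_add_rdistrib scaleR_matrix_vector_assoc[symmetric] inner_add_right)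
    moreover have "a * (v \<bullet> (A *v v)) > 0" using assms(1,3) that by (simp add: pos_def_def)
    moreover have "b * (v \<bullet> (B *v v)) \<ge> 0" using assms(2,4) by (simp add: pos_semidef_def)
    ultimately show ?thesis by simp
  qed
  ultimately show ?thesis by (simp add: pos_def_def)
qed

text \<open>Add the strict tangent inequalities at the midpoint for the two endpoints: the linear terms cancel.\<close>
lemma finite_objective_midpoint:
  fixes A B S :: "real^'n^'n"
  assumes A: "pos_def A" and B: "pos_def B" and ne: "A \<noteq> B"
  shows "pos_def (midpoint A B)"
    and "2 * finite_objective S (midpoint A B) < finite_objective S A + finite_objective S B"
proof -
  define M where "M = midpoint A B"
  have "M = (1/2) *\<^sub>R A + (1/2) *\<^sub>R B" by (simp add: M_def midpoint_def algebra_simps)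
  then show M: "pos_def (midpoint A B)"
    using pos_def_convex_combination[OF A pos_def_imp_pos_semidef[OF B]] M_def by simp
  define G where "G = S - matrix_inv M"
  have "A \<noteq> M" "B \<noteq> M" using ne unfolding M_def by (metis midpoint_eq_endpoint)+
  then have "finite_objective S M + trace ((A - M) ** G) < finite_objective S A"
    "finite_objective S M + trace ((B - M) ** G) < finite_objective S B"
    using finite_objective_tangent(2)[OF A M[folded M_def]]
      finite_objective_tangent(2)[OF B M[folded M_def]] unfolding G_def by auto
  moreover have "trace ((A - M) ** G) + trace ((B - M) ** G) = trace (((A - M) + (B - M)) ** G)"
    by (rule linear_add[OF trace_mult_linear, symmetric])
  moreover have "(A - M) + (B - M) = 0"
    by (simp add: M_def midpoint_def scaleR_2[symmetric] algebra_simps)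
  then have "trace (((A - M) + (B - M)) ** G) = 0"
    by (simp only: linear_0[OF trace_mult_linear])
  ultimately show "2 * finite_objective S (midpoint A B) < finite_objective S A + finite_objective S B"
    unfolding M_def by linarith
qed

section \<open>Coercivity and compact sublevel sets\<close>

lemma form_axis: 
  fixes A :: "real^'n^'n"
  shows "axis k 1 \<bullet> (A *v axis j 1) = A $ k $ j"
  by (simp add: matrix_vector_mult_basis inner_axis_axis inner_axis' column_def)

lemma pos_semidef_entry_bound:
  fixes A :: "real^'n^'n"
  assumes "pos_semidef A"
  shows "0 \<le> trace A" and "\<bar>A $ j $ k\<bar> \<le> trace A"
proof -
  have sym: "transpose A = A" and nonneg: "\<And>v. 0 \<le> v \<bullet> (A *v v)"
    using assms by (auto simp: pos_semidef_def)
  have diag: "0 \<le> A $ i $ i" for i using nonneg[of "axis i 1"] by (simp add: form_axis)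
  then show "0 \<le> trace A" by (simp add: trace_def sum_nonneg)
  have diag_le: "A $ i $ i \<le> trace A" for i
    unfolding trace_def using diag by (intro member_le_sum) auto
  have "A $ j $ k = A $ k $ j" using sym by (metis transpose_def vec_lambda_beta)
  moreover have "0 \<le> A $ j $ j + 2 * s * A $ k $ j + s\<^sup>2 * A $ k $ k" for s
    using nonneg[of "axis j 1 + s *\<^sub>R axis k 1"] by (simp add: symmetric_form_expand[OF sym] form_axis)
  from this[of 1] this[of "-1"]
  have "\<bar>A $ k $ j\<bar> * 2 \<le> A $ j $ j + A $ k $ k" by simp
  ultimately show "\<bar>A $ j $ k\<bar> \<le> trace A" using diag_le[of j] diag_le[of k] by simp
qed

lemma trace_mult_entries:
  fixes A B :: "real^'n^'n"
  shows "trace (A ** B) = (\<Sum>j\<in>UNIV. \<Sum>k\<in>UNIV. A $ j $ k * B $ k $ j)"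
  by (simp add: trace_def matrix_matrix_mult_def)

text \<open>On the sign-constrained cone the linear term then outweighs \<open>ln (det \<Omega>)\<close> at infinity, which makes
all minimizations well posed even for singular \<open>S\<close>.\<close>
definition coercive_on_M :: "real^'n^'n \<Rightarrow> bool" where
  "coercive_on_M S \<longleftrightarrow> (\<exists>c>0. \<forall>\<Omega>\<in>M_closed. c * trace \<Omega> \<le> trace (\<Omega> ** S))"

text \<open>With \<open>r j = sqrt (S j j)\<close>, choose \<open>\<rho> < 1\<close> nonnegative and at least every correlation. The matrix
with the diagonal of \<open>S\<close> and off-diagonal entries \<open>\<rho> r j r k\<close> dominates \<open>S\<close> off the diagonal, so replacing \<open>S\<close> by it
does not increase \<open>tr (\<Omega> S)\<close> for sign-constrained \<open>\<Omega>\<close>. It equals \<open>(1 - \<rho>) diag S + \<rho> r r\<^sup>T\<close>, and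
the second summand contributes \<open>\<rho> (r \<bullet> \<Omega> r) \<ge> 0\<close>.\<close>
lemma coercive_on_M_if_no_perfect_correlation:
  fixes S :: "real^'n^'n"
  assumes diag: "\<And>j. 0 < S $ j $ j"
    and off: "\<And>j k. j \<noteq> k \<Longrightarrow> S $ j $ k < sqrt (S $ j $ j * S $ k $ k)"
  shows "coercive_on_M S"
proof -
  define r :: "real^'n" where "r = (\<chi> j. sqrt (S $ j $ j))"
  have r: "r $ j > 0" "r $ j * r $ j = S $ j $ j" for j
    using diag[of j] by (auto simp: r_def)
  define R where "R = insert 0 ((\<lambda>(j, k). S $ j $ k / (r $ j * r $ k)) ` {(j, k). j \<noteq> k})"
  define \<rho> where "\<rho> = Max R"
  have fin: "finite R" unfolding R_def by simp
  have "0 \<le> \<rho>" unfolding \<rho>_def using fin by (intro Max_ge) (auto simp: R_def)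
  have "S $ j $ k / (r $ j * r $ k) < 1" if "j \<noteq> k" for j k
    using off[OF that] r(1)[of j] r(1)[of k] by (simp add: r_def real_sqrt_mult)
  then have "\<rho> < 1" unfolding \<rho>_def using fin by (subst Max_less_iff) (auto simp: R_def)
  have S_le: "S $ j $ k \<le> \<rho> * (r $ j * r $ k)" if "j \<noteq> k" for j k
  proof -
    have "S $ j $ k / (r $ j * r $ k) \<le> \<rho>"
      unfolding \<rho>_def using fin that by (intro Max_ge) (auto simp: R_def)
    then show ?thesis using r(1)[of j] r(1)[of k] by (simp add: field_simps)
  qed
  define m where "m = Min (range (\<lambda>j. S $ j $ j))"
  have "m > 0" unfolding m_def using diag by (subst Min_gr_iff) auto
  have m_le: "m \<le> S $ j $ j" for j unfolding m_def by (intro Min_le) auto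
  have "(1 - \<rho>) * m * trace \<Omega> \<le> trace (\<Omega> ** S)" if \<Omega>: "\<Omega> \<in> M_closed" for \<Omega>
  proof -
    have nonneg: "\<And>v. 0 \<le> v \<bullet> (\<Omega> *v v)" and sign: "\<And>j k. j \<noteq> k \<Longrightarrow> \<Omega> $ j $ k \<le> 0"
      using \<Omega> by (auto simp: M_closed_def pos_semidef_def)
    have \<Omega>_diag: "0 \<le> \<Omega> $ j $ j" for j using nonneg[of "axis j 1"] by (simp add: form_axis)
    have "(1 - \<rho>) * m * trace \<Omega> = (1 - \<rho>) * (\<Sum>j\<in>UNIV. m * \<Omega> $ j $ j)"
      by (simp add: trace_def sum_distrib_left mult_ac)
    also have "\<dots> \<le> (1 - \<rho>) * (\<Sum>j\<in>UNIV. S $ j $ j * \<Omega> $ j $ j)"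
      using \<open>\<rho> < 1\<close> m_le \<Omega>_diag by (intro mult_left_mono sum_mono mult_right_mono) auto
    also have "\<dots> \<le> (1 - \<rho>) * (\<Sum>j\<in>UNIV. S $ j $ j * \<Omega> $ j $ j) + \<rho> * (r \<bullet> (\<Omega> *v r))"
      using nonneg[of r] \<open>0 \<le> \<rho>\<close> by simp
    also have "r \<bullet> (\<Omega> *v r) = (\<Sum>j\<in>UNIV. \<Sum>k\<in>UNIV. \<Omega> $ j $ k * (r $ j * r $ k))"
      by (simp add: inner_vec_def matrix_vector_mult_def sum_distrib_left mult_ac)
    also have "(\<Sum>j\<in>UNIV. S $ j $ j * \<Omega> $ j $ j)
        = (\<Sum>j\<in>UNIV. \<Sum>k\<in>UNIV. if j = k then S $ j $ j * \<Omega> $ j $ j else 0)" by simp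
    also have "(1 - \<rho>) * \<dots> + \<rho> * (\<Sum>j\<in>UNIV. \<Sum>k\<in>UNIV. \<Omega> $ j $ k * (r $ j * r $ k))
        = (\<Sum>j\<in>UNIV. \<Sum>k\<in>UNIV. (1 - \<rho>) * (if j = k then S $ j $ j * \<Omega> $ j $ j else 0)
            + \<rho> * (\<Omega> $ j $ k * (r $ j * r $ k)))"
      by (simp only: sum.distrib sum_distrib_left)
    also have "\<dots> \<le> (\<Sum>j\<in>UNIV. \<Sum>k\<in>UNIV. \<Omega> $ j $ k * S $ k $ j)"
    proof (intro sum_mono)
      fix j k
      show "(1 - \<rho>) * (if j = k then S $ j $ j * \<Omega> $ j $ j else 0)
            + \<rho> * (\<Omega> $ j $ k * (r $ j * r $ k)) \<le> \<Omega> $ j $ k * S $ k $ j"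
      proof (cases "j = k")
        case True
        then show ?thesis using r(2)[of k] by (simp add: algebra_simps)
      next
        case False
        then have "\<Omega> $ j $ k * (\<rho> * (r $ k * r $ j)) \<le> \<Omega> $ j $ k * S $ k $ j"
          using S_le[of k j] sign[of j k] by (intro mult_left_mono_neg) auto
        then show ?thesis using False by (simp add: algebra_simps)
      qed
    qed
    also have "\<dots> = trace (\<Omega> ** S)" by (simp add: trace_mult_entries)
    finally show ?thesis .
  qed
  moreover have "(1 - \<rho>) * m > 0" using \<open>\<rho> < 1\<close> \<open>m > 0\<close> by simp
  ultimately show ?thesis unfolding coercive_on_M_def by blast
qed

lemma continuous_on_det: "continuous_on X (det :: real^'n^'n \<Rightarrow> real)"
  unfolding det_def by (intro continuous_intros)

lemma continuous_on_trace_mult: "continuous_on X (\<lambda>A :: real^'n^'n. trace (A ** S))"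
  by (intro linear_continuous_on linear_linear[THEN iffD2] trace_mult_linear)

lemma closed_M_closed: "closed (M_closed :: (real^'n^'n) set)"
proof -
  have "M_closed = {A :: real^'n^'n. (\<forall>j k. A $ k $ j = A $ j $ k) \<and> (\<forall>v. 0 \<le> v \<bullet> (A *v v)) \<and>
      (\<forall>j k. j \<noteq> k \<longrightarrow> A $ j $ k \<le> 0)}"
    by (auto simp: M_closed_def pos_semidef_def transpose_def vec_eq_iff)
  moreover have cont: "continuous_on UNIV (\<lambda>A :: real^'n^'n. v \<bullet> (A *v v))" for v
    unfolding inner_vec_def matrix_vector_mult_def by (simp, intro continuous_intros)
  have "closed {A :: real^'n^'n. (\<forall>j k. A $ k $ j = A $ j $ k) \<and> (\<forall>v. 0 \<le> v \<bullet> (A *v v)) \<and>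
      (\<forall>j k. j \<noteq> k \<longrightarrow> A $ j $ k \<le> 0)}"
    by (intro closed_Collect_conj closed_Collect_all closed_Collect_eq closed_Collect_le
        closed_Collect_imp open_Collect_const cont)
      (intro continuous_intros)+
  ultimately show ?thesis by simp
qed

definition sublevel :: "real^'n^'n \<Rightarrow> real \<Rightarrow> (real^'n^'n) set" where
  "sublevel S c = {\<Omega> \<in> M_closed. pos_def \<Omega> \<and> finite_objective S \<Omega> \<le> c}"

lemma pos_def_scaled_identity: "0 < r \<Longrightarrow> pos_def (r *\<^sub>R mat 1 :: real^'n^'n)"
  by (simp add: pos_def_def scaleR_matrix_vector_assoc[symmetric] transpose_scalar)

text \<open>Boundedness: the tangent to \<open>ln (det \<Omega>)\<close> at \<open>(2/a) I\<close> has slope \<open>a/2\<close> in \<open>tr \<Omega>\<close>, half of the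
coercivity constant \<open>a\<close>, so \<open>F\<close> controls \<open>tr \<Omega>\<close>, which controls all entries. Closedness: the
sublevel condition is equivalent to \<open>det \<Omega> \<ge> exp (tr (\<Omega> S) - c)\<close>, which makes sense for
semidefinite \<open>\<Omega>\<close> and forces definiteness.\<close>
lemma compact_sublevel:
  fixes S :: "real^'n^'n"
  assumes "coercive_on_M S"
  shows "compact (sublevel S c)"
proof -
  obtain a where a: "a > 0" "\<And>\<Omega>. \<Omega> \<in> M_closed \<Longrightarrow> a * trace \<Omega> \<le> trace (\<Omega> ** S)"
    using assms unfolding coercive_on_M_def by blast
  define B :: "real^'n^'n" where "B = (2 / a) *\<^sub>R mat 1"
  define b where "b = ln (det B) - real CARD('n)"
  have B: "pos_def B" unfolding B_def using a(1) by (intro pos_def_scaled_identity) simp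
  have inv: "matrix_inv B = (a / 2) *\<^sub>R mat 1"
    by (rule matrix_inv_eqI)
      (use a(1) in \<open>simp add: B_def scalar_matrix_assoc[symmetric] matrix_scalar_ac\<close>)
  have tr_bound: "trace \<Omega> \<le> 2 / a * (c + b)" if "\<Omega> \<in> sublevel S c" for \<Omega>
  proof -
    have \<Omega>: "\<Omega> \<in> M_closed" "pos_def \<Omega>" "finite_objective S \<Omega> \<le> c"
      using that by (auto simp: sublevel_def)
    have "trace (matrix_inv B ** \<Omega>) = a / 2 * trace \<Omega>"
      by (simp add: inv scalar_matrix_assoc[symmetric] trace_def sum_distrib_left)
    then have "ln (det \<Omega>) \<le> b + a / 2 * trace \<Omega>"
      using log_det_tangent(1)[OF \<Omega>(2) B] by (simp add: b_def)
    then have "a * trace \<Omega> - (b + a / 2 * trace \<Omega>) \<le> c"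
      using a(2)[OF \<Omega>(1)] \<Omega>(3) by (simp add: finite_objective_def)
    then show ?thesis using a(1) by (simp add: field_simps)
  qed
  have "bounded (sublevel S c)"
  proof (rule boundedI)
    fix \<Omega> assume \<Omega>: "\<Omega> \<in> sublevel S c"
    then have psd: "pos_semidef \<Omega>" by (simp add: sublevel_def M_closed_def)
    have "norm \<Omega> \<le> (\<Sum>j\<in>UNIV. norm (\<Omega> $ j))"
      unfolding norm_vec_def[of \<Omega>] by (intro L2_set_le_sum) simp
    also have "\<dots> \<le> (\<Sum>j\<in>(UNIV::'n set). \<Sum>k\<in>(UNIV::'n set). \<bar>\<Omega> $ j $ k\<bar>)"
      by (intro sum_mono norm_le_l1_cart)
    also have "\<dots> \<le> (\<Sum>j\<in>(UNIV::'n set). \<Sum>k\<in>(UNIV::'n set). 2 / a * (c + b))"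
      using pos_semidef_entry_bound(2)[OF psd] tr_bound[OF \<Omega>] by (intro sum_mono) (meson order_trans)
    finally show "norm \<Omega> \<le> (\<Sum>j\<in>(UNIV::'n set). \<Sum>k\<in>(UNIV::'n set). 2 / a * (c + b))" .
  qed
  moreover have "sublevel S c = M_closed \<inter> {\<Omega>. exp (trace (\<Omega> ** S) - c) \<le> det \<Omega>}"
  proof (intro set_eqI iffI)
    fix \<Omega> assume "\<Omega> \<in> sublevel S c"
    then have \<Omega>: "\<Omega> \<in> M_closed" "pos_def \<Omega>" "finite_objective S \<Omega> \<le> c"
      by (auto simp: sublevel_def)
    then have "trace (\<Omega> ** S) - c \<le> ln (det \<Omega>)" by (simp add: finite_objective_def)
    then show "\<Omega> \<in> M_closed \<inter> {\<Omega>. exp (trace (\<Omega> ** S) - c) \<le> det \<Omega>}"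
      using \<Omega>(1) pos_def_det_pos[OF \<Omega>(2)] by (simp add: ln_ge_iff)
  next
    fix \<Omega> assume "\<Omega> \<in> M_closed \<inter> {\<Omega>. exp (trace (\<Omega> ** S) - c) \<le> det \<Omega>}"
    then have \<Omega>: "\<Omega> \<in> M_closed" and le: "exp (trace (\<Omega> ** S) - c) \<le> det \<Omega>" by auto
    have pos: "det \<Omega> > 0" using le by (meson exp_gt_zero less_le_trans)
    then have "pos_def \<Omega>"
      using \<Omega> by (intro pos_semidef_det_nonzero_imp_pos_def) (auto simp: M_closed_def)
    moreover have "trace (\<Omega> ** S) - c \<le> ln (det \<Omega>)" using le pos by (simp add: ln_ge_iff)
    ultimately show "\<Omega> \<in> sublevel S c" using \<Omega> by (simp add: sublevel_def finite_objective_def)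
  qed
  moreover have "closed {\<Omega> :: real^'n^'n. exp (trace (\<Omega> ** S) - c) \<le> det \<Omega>}"
    by (intro closed_Collect_le continuous_intros continuous_on_det continuous_on_trace_mult)
  ultimately show ?thesis
    by (simp add: compact_eq_bounded_closed closed_Int closed_M_closed)
qed

lemma tendsto_finite_objective:
  fixes A S :: "real^'n^'n"
  assumes f: "(f \<longlongrightarrow> A) F" and A: "pos_def A"
  shows "((\<lambda>x. finite_objective S (f x)) \<longlongrightarrow> finite_objective S A) F"
proof -
  have "isCont (det :: real^'n^'n \<Rightarrow> real) A" "isCont (\<lambda>A. trace (A ** S)) A"
    using continuous_on_det[of UNIV] continuous_on_trace_mult[of UNIV]
    by (auto simp: continuous_on_eq_continuous_at)
  then have "((\<lambda>x. det (f x)) \<longlongrightarrow> det A) F" "((\<lambda>x. trace (f x ** S)) \<longlongrightarrow> trace (A ** S)) F"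
    using f isCont_tendsto_compose by blast+
  then show ?thesis
    unfolding finite_objective_def using pos_def_det_pos[OF A] by (intro tendsto_intros) auto
qed

lemma norm_matrix_vector_mult_le:
  fixes M :: "real^'n^'m"
  shows "norm (M *v v) \<le> norm M * norm v"
proof -
  have "norm (M *v v) = L2_set (\<lambda>i. \<bar>M $ i \<bullet> v\<bar>) UNIV"
    by (simp add: norm_vec_def matrix_vector_mul_component)
  also have "\<dots> \<le> L2_set (\<lambda>i. norm (M $ i) * norm v) UNIV"
    by (intro L2_set_mono Cauchy_Schwarz_ineq2) auto
  also have "\<dots> = norm M * norm v"
    by (simp add: L2_set_left_distrib norm_vec_def[of M])
  finally show ?thesis .
qed

text \<open>Positive definiteness is an open condition among symmetric matrices: perturbing \<open>A\<close> by less than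
its smallest eigenvalue preserves it.\<close>
lemma eventually_pos_def:
  fixes A :: "real^'n^'n"
  assumes f: "(f \<longlongrightarrow> A) F" and A: "pos_def A" and sym: "\<forall>\<^sub>F x in F. transpose (f x) = f x"
  shows "\<forall>\<^sub>F x in F. pos_def (f x)"
proof -
  obtain m where m: "m > 0" "\<And>v. m * (norm v)\<^sup>2 \<le> v \<bullet> (A *v v)"
    using pos_def_coercive[OF A] by blast
  have "\<forall>\<^sub>F x in F. dist (f x) A < m" using f m(1) by (rule tendstoD)
  then show ?thesis using sym
  proof eventually_elim
    case (elim x)
    have "0 < v \<bullet> (f x *v v)" if "v \<noteq> 0" for v
    proof -
      have "\<bar>v \<bullet> ((f x - A) *v v)\<bar> \<le> norm v * norm ((f x - A) *v v)" by (rule Cauchy_Schwarz_ineq2)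
      also have "\<dots> \<le> norm v * (norm (f x - A) * norm v)"
        by (intro mult_left_mono norm_matrix_vector_mult_le) simp
      also have "\<dots> = norm (f x - A) * (norm v)\<^sup>2" by (simp add: power2_eq_square)
      also have "\<dots> < m * (norm v)\<^sup>2"
        using elim that by (intro mult_strict_right_mono) (auto simp: dist_norm)
      also have "\<dots> \<le> v \<bullet> (A *v v)" by (rule m)
      finally have "\<bar>v \<bullet> ((f x - A) *v v)\<bar> < v \<bullet> (A *v v)" .
      moreover have "v \<bullet> (f x *v v) = v \<bullet> (A *v v) + v \<bullet> ((f x - A) *v v)"
        by (simp add: matrix_vector_mult_diff_rdistrib inner_diff_right)
      ultimately show ?thesis by linarith
    qed
    then show ?case using elim by (simp add: pos_def_def)
  qed
qed

section \<open>Unique minimizers and block steps\<close>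

lemma is_arg_min_objective_iff:
  fixes S :: "real^'n^'n"
  assumes "P \<in> C" "pos_def P"
  shows "is_arg_min (objective S) (\<lambda>\<Omega>. \<Omega> \<in> C) A \<longleftrightarrow>
    A \<in> C \<and> pos_def A \<and> (\<forall>B\<in>C. pos_def B \<longrightarrow> finite_objective S A \<le> finite_objective S B)"
proof
  assume min: "is_arg_min (objective S) (\<lambda>\<Omega>. \<Omega> \<in> C) A"
  then have A: "A \<in> C" and le: "\<And>B. B \<in> C \<Longrightarrow> \<not> objective S B < objective S A"
    by (auto simp: is_arg_min_def)
  have "pos_def A"
  proof (rule ccontr)
    assume "\<not> pos_def A"
    then show False
      using le[OF assms(1)] by (simp add: objective_not_pos_def objective_pos_def[OF assms(2)])
  qed
  then show "A \<in> C \<and> pos_def A \<and>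
      (\<forall>B\<in>C. pos_def B \<longrightarrow> finite_objective S A \<le> finite_objective S B)"
    using A le by (metis ereal_less_eq(3) not_less objective_pos_def)
next
  assume *: "A \<in> C \<and> pos_def A \<and>
      (\<forall>B\<in>C. pos_def B \<longrightarrow> finite_objective S A \<le> finite_objective S B)"
  have "\<not> objective S B < objective S A" if "B \<in> C" for B
    using * that by (cases "pos_def B") (auto simp: objective_pos_def objective_not_pos_def not_less)
  then show "is_arg_min (objective S) (\<lambda>\<Omega>. \<Omega> \<in> C) A" using * by (auto simp: is_arg_min_def)
qed

text \<open>Existence comes from the compact sublevel sets, uniqueness from strict convexity. The set \<open>C\<close> is the whole
cone for the estimator; for one step of the algorithm it consists of the matrices in the cone that
agree with the current iterate outside one row and column.\<close>
lemma ex1_objective_minimizer: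
  fixes S :: "real^'n^'n"
  assumes S: "coercive_on_M S" and C: "closed C" "convex C" "C \<subseteq> M_closed"
    and P: "P \<in> C" "pos_def P"
  shows "\<exists>!\<Omega>. is_arg_min (objective S) (\<lambda>\<Omega>. \<Omega> \<in> C) \<Omega>"
proof (rule ex_ex1I)
  define K where "K = C \<inter> sublevel S (finite_objective S P)"
  have "compact K" unfolding K_def using C(1) compact_sublevel[OF S] by (rule closed_Int_compact)
  moreover have "P \<in> K" using P C(3) by (auto simp: K_def sublevel_def)
  moreover have "continuous_on K (finite_objective S)"
    unfolding continuous_on
    by (auto simp: K_def sublevel_def intro!: tendsto_finite_objective tendsto_ident_at)
  ultimately obtain A where A: "A \<in> K"
    and le: "\<And>B. B \<in> K \<Longrightarrow> finite_objective S A \<le> finite_objective S B"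
    using continuous_attains_inf[of K "finite_objective S"] by blast
  have "finite_objective S A \<le> finite_objective S B" if "B \<in> C" "pos_def B" for B
  proof (cases "finite_objective S B \<le> finite_objective S P")
    case True
    then show ?thesis using le[of B] that C(3) by (auto simp: K_def sublevel_def)
  next
    case False
    then show ?thesis using A by (simp add: K_def sublevel_def)
  qed
  then show "\<exists>\<Omega>. is_arg_min (objective S) (\<lambda>\<Omega>. \<Omega> \<in> C) \<Omega>"
    using A unfolding is_arg_min_objective_iff[OF P] by (auto simp: K_def sublevel_def)
next
  fix A B
  assume "is_arg_min (objective S) (\<lambda>\<Omega>. \<Omega> \<in> C) A" "is_arg_min (objective S) (\<lambda>\<Omega>. \<Omega> \<in> C) B"
  then have A: "A \<in> C" "pos_def A"
      "\<And>D. D \<in> C \<Longrightarrow> pos_def D \<Longrightarrow> finite_objective S A \<le> finite_objective S D"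
    and B: "B \<in> C" "pos_def B"
      "\<And>D. D \<in> C \<Longrightarrow> pos_def D \<Longrightarrow> finite_objective S B \<le> finite_objective S D"
    unfolding is_arg_min_objective_iff[OF P] by blast+
  show "A = B"
  proof (rule ccontr)
    assume ne: "A \<noteq> B"
    have "midpoint A B \<in> C"
      using closed_segment_subset[OF A(1) B(1) C(2)] midpoint_in_closed_segment by blast
    then have "finite_objective S A \<le> finite_objective S (midpoint A B)"
      "finite_objective S B \<le> finite_objective S (midpoint A B)"
      using A(3) B(3) finite_objective_midpoint(1)[OF A(2) B(2) ne] by blast+
    with finite_objective_midpoint(2)[OF A(2) B(2) ne, of S] show False by linarith
  qed
qed

lemma M_closed_symmetric: "A \<in> M_closed \<Longrightarrow> A $ a $ b = A $ b $ a"
  unfolding M_closed_def pos_semidef_def by (metis (mono_tags) mem_Collect_eq transpose_def vec_lambda_beta)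

lemma convex_M_closed: "convex (M_closed :: (real^'n^'n) set)"
proof (rule convexI)
  fix A B :: "real^'n^'n" and u v :: real
  assume A: "A \<in> M_closed" and B: "B \<in> M_closed" and uv: "0 \<le> u" "0 \<le> v" "u + v = 1"
  have "transpose (u *\<^sub>R A + v *\<^sub>R B) = u *\<^sub>R A + v *\<^sub>R B"
    using M_closed_symmetric[OF A] M_closed_symmetric[OF B] by (simp add: transpose_def vec_eq_iff)
  moreover have "0 \<le> x \<bullet> ((u *\<^sub>R A + v *\<^sub>R B) *v x)" for x
  proof -
    have "x \<bullet> ((u *\<^sub>R A + v *\<^sub>R B) *v x) = u * (x \<bullet> (A *v x)) + v * (x \<bullet> (B *v x))"
      by (simp add: matrix_vector_mult_add_rdistrib scaleR_matrix_vector_assoc[symmetric] inner_add_right)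
    then show ?thesis using A B uv by (simp add: M_closed_def pos_semidef_def)
  qed
  moreover have "(u *\<^sub>R A + v *\<^sub>R B) $ j $ k \<le> 0" if "j \<noteq> k" for j k
    using A B uv that by (simp add: M_closed_def add_nonpos_nonpos mult_nonneg_nonpos)
  ultimately show "u *\<^sub>R A + v *\<^sub>R B \<in> M_closed" by (simp add: M_closed_def pos_semidef_def)
qed

text \<open>The feasible set of one block step as a set of matrices, so that block
problems and the full problem are minimizations of the same function.\<close>
definition block_slice :: "real^'n^'n \<Rightarrow> 'n \<Rightarrow> (real^'n^'n) set" where
  "block_slice \<Omega> j = {A \<in> M_closed. \<forall>a b. a \<noteq> j \<longrightarrow> b \<noteq> j \<longrightarrow> A $ a $ b = \<Omega> $ a $ b}"

lemma block_slice_self: "\<Omega> \<in> M_closed \<Longrightarrow> \<Omega> \<in> block_slice \<Omega> j"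
  by (simp add: block_slice_def)

lemma closed_block_slice: "closed (block_slice \<Omega> j)"
proof -
  have "block_slice \<Omega> j = M_closed \<inter> {A. \<forall>a b. a \<noteq> j \<longrightarrow> b \<noteq> j \<longrightarrow> A $ a $ b = \<Omega> $ a $ b}"
    by (auto simp: block_slice_def)
  moreover have "closed {A. \<forall>a b. a \<noteq> j \<longrightarrow> b \<noteq> j \<longrightarrow> A $ a $ b = \<Omega> $ a $ b}"
    by (intro closed_Collect_all closed_Collect_imp open_Collect_const closed_Collect_eq continuous_intros)
  ultimately show ?thesis by (simp add: closed_Int closed_M_closed)
qed

lemma convex_block_slice: "convex (block_slice \<Omega> j)"
proof (rule convexI)
  fix A B and u v :: real
  assume "A \<in> block_slice \<Omega> j" "B \<in> block_slice \<Omega> j" and uv: "0 \<le> u" "0 \<le> v" "u + v = 1"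
  moreover have "u * c + v * c = c" for c using uv(3) by (metis distrib_right mult_1)
  ultimately show "u *\<^sub>R A + v *\<^sub>R B \<in> block_slice \<Omega> j"
    using convexD[OF convex_M_closed] by (auto simp: block_slice_def)
qed

lemma replace_row_col_row: "replace_row_col \<Omega> j w $ j = w"
  by (simp add: replace_row_col_def vec_eq_iff)

lemma replace_row_col_in_block_slice:
  assumes "\<Omega> \<in> M_closed"
  shows "replace_row_col \<Omega> j w \<in> block_slice \<Omega> j \<longleftrightarrow> block_feasible \<Omega> j w"
  using assms
  by (auto simp: block_slice_def block_feasible_def M_closed_def replace_row_col_def split: if_splits)

lemma replace_row_col_own_row:
  assumes "A \<in> block_slice \<Omega> j"
  shows "replace_row_col \<Omega> j (A $ j) = A"
  using assms M_closed_symmetric[of A]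
  by (auto simp: block_slice_def replace_row_col_def vec_eq_iff)

lemma block_step_is_arg_min:
  fixes S \<Omega> :: "real^'n^'n"
  assumes S: "coercive_on_M S" and \<Omega>: "\<Omega> \<in> M_closed" "pos_def \<Omega>"
  shows "is_arg_min (objective S) (\<lambda>A. A \<in> block_slice \<Omega> j) (replace_row_col \<Omega> j (block_argmin S \<Omega> j))"
proof -
  let ?g = "\<lambda>w. objective S (replace_row_col \<Omega> j w)"
  have iff: "is_arg_min ?g (block_feasible \<Omega> j) w \<longleftrightarrow>
      is_arg_min (objective S) (\<lambda>A. A \<in> block_slice \<Omega> j) (replace_row_col \<Omega> j w)" for w
    unfolding is_arg_min_def replace_row_col_in_block_slice[OF \<Omega>(1)]
    by (metis replace_row_col_in_block_slice[OF \<Omega>(1)] replace_row_col_own_row)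
  have "block_slice \<Omega> j \<subseteq> M_closed" by (auto simp: block_slice_def)
  then have ex1: "\<exists>!A. is_arg_min (objective S) (\<lambda>A. A \<in> block_slice \<Omega> j) A"
    by (rule ex1_objective_minimizer[OF S closed_block_slice convex_block_slice _
        block_slice_self[OF \<Omega>(1)] \<Omega>(2)])
  then obtain A where A: "is_arg_min (objective S) (\<lambda>A. A \<in> block_slice \<Omega> j) A" by blast
  then have "replace_row_col \<Omega> j (A $ j) = A"
    by (intro replace_row_col_own_row) (simp add: is_arg_min_def)
  with A ex1 have "\<exists>!w. is_arg_min ?g (block_feasible \<Omega> j) w"
    unfolding iff by (metis replace_row_col_row)
  then have "is_arg_min ?g (block_feasible \<Omega> j) (block_argmin S \<Omega> j)"
    unfolding block_argmin_def by (rule theI')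
  then show ?thesis by (simp only: iff)
qed

lemma estimator_is_arg_min:
  fixes S :: "real^'n^'n"
  assumes "coercive_on_M S"
  shows "is_arg_min (objective S) (\<lambda>\<Omega>. \<Omega> \<in> M_closed) (estimator S)"
    and "is_arg_min (objective S) (\<lambda>\<Omega>. \<Omega> \<in> M_closed) A \<Longrightarrow> A = estimator S"
proof -
  have P: "pos_def (mat 1 :: real^'n^'n)" using pos_def_scaled_identity[of 1] by simp
  then have "(mat 1 :: real^'n^'n) \<in> M_closed"
    by (auto simp: M_closed_def mat_def intro: pos_def_imp_pos_semidef)
  then have ex1: "\<exists>!\<Omega>. is_arg_min (objective S) (\<lambda>\<Omega>. \<Omega> \<in> M_closed) \<Omega>"
    using ex1_objective_minimizer[OF assms closed_M_closed convex_M_closed order.refl _ P] by blast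
  then show 1: "is_arg_min (objective S) (\<lambda>\<Omega>. \<Omega> \<in> M_closed) (estimator S)"
    unfolding estimator_def by (rule theI')
  show "A = estimator S" if "is_arg_min (objective S) (\<lambda>\<Omega>. \<Omega> \<in> M_closed) A"
    using ex1 1 that by blast
qed

section \<open>Blockwise optimality is global optimality\<close>

text \<open>By Cramer's rule, the entries of the inverse are quotients of determinants, hence continuous.\<close>
lemma tendsto_matrix_inv:
  fixes A :: "real^'n^'n"
  assumes f: "(f \<longlongrightarrow> A) F" and A: "det A \<noteq> 0"
  shows "((\<lambda>x. matrix_inv (f x)) \<longlongrightarrow> matrix_inv A) F"
proof -
  define cramer_inv :: "real^'n^'n \<Rightarrow> real^'n^'n" where
    "cramer_inv B = (\<chi> k j. det (\<chi> i l. if l = k then axis j 1 $ i else B $ i $ l) / det B)" for B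
  have inv: "matrix_inv B = cramer_inv B" if B: "det B \<noteq> 0" for B
  proof (rule matrix_inv_eqI)
    have "column j (B ** cramer_inv B) = column j (mat 1)" for j
    proof -
      have "column j (cramer_inv B) = (\<chi> k. det (\<chi> i l. if l = k then axis j 1 $ i else B $ i $ l) / det B)"
        by (simp add: cramer_inv_def column_def)
      then have "B *v column j (cramer_inv B) = axis j 1"
        using cramer[OF B] by blast
      then show ?thesis
        by (simp add: column_def matrix_matrix_mult_def matrix_vector_mult_def mat_def axis_def vec_eq_iff)
    qed
    then show "B ** cramer_inv B = mat 1" by (simp add: column_def vec_eq_iff)
  qed
  have cont: "((\<lambda>x. det (g x)) \<longlongrightarrow> det B) F" if "(g \<longlongrightarrow> B) F" for g :: "_ \<Rightarrow> real^'n^'n" and B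
    using continuous_on_tendsto_compose[OF continuous_on_det[of UNIV] that] by simp
  have entry: "((\<lambda>x. f x $ i $ l) \<longlongrightarrow> A $ i $ l) F" for i l
    by (intro tendsto_vec_nth f)
  have "((\<lambda>x. cramer_inv (f x)) \<longlongrightarrow> cramer_inv A) F"
    unfolding cramer_inv_def
    by (intro tendsto_vec_lambda tendsto_divide cont f A) (auto intro: entry)
  moreover have "\<forall>\<^sub>F x in F. cramer_inv (f x) = matrix_inv (f x)"
    using tendsto_imp_eventually_ne[OF cont[OF f] A] by eventually_elim (simp add: inv)
  ultimately show ?thesis
    using inv[OF A] by (simp add: Lim_transform_eventually)
qed

text \<open>The points \<open>A + t D\<close> with \<open>0 \<le> t \<le> 1\<close> satisfy the sign constraints, and for small \<open>t\<close> they are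
positive definite, so the objective is at least as large there as at \<open>A\<close>. The tangent inequality
taken at \<open>A + t D\<close>, not at \<open>A\<close>, turns this into a sign of the directional derivative at \<open>A + t D\<close>, and \<open>t \<longrightarrow> 0\<close> gives the claim.
In this way no derivative of the determinant is computed.\<close>
lemma block_optimal_imp_stationary:
  fixes S A D :: "real^'n^'n"
  assumes A: "A \<in> M_closed" "pos_def A"
    and opt: "\<And>B. B \<in> block_slice A i \<Longrightarrow> pos_def B \<Longrightarrow> finite_objective S A \<le> finite_objective S B"
    and D_sym: "transpose D = D"
    and D_block: "\<And>a b. a \<noteq> i \<Longrightarrow> b \<noteq> i \<Longrightarrow> D $ a $ b = 0"
    and D_sign: "\<And>a b. a \<noteq> b \<Longrightarrow> A $ a $ b + D $ a $ b \<le> 0"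
  shows "0 \<le> trace (D ** (S - matrix_inv A))"
proof -
  define B where "B t = A + t *\<^sub>R D" for t
  have "((\<lambda>t. B t) \<longlongrightarrow> A + 0 *\<^sub>R D) (at_right 0)"
    unfolding B_def by (intro tendsto_intros)
  then have lim: "(B \<longlongrightarrow> A) (at_right 0)" by simp
  have sym: "transpose (B t) = B t" for t
    using A(2) D_sym by (simp add: B_def pos_def_def transpose_def vec_eq_iff)
  have "\<forall>\<^sub>F t in at_right 0. pos_def (B t)"
    using eventually_pos_def[OF lim A(2)] sym by simp
  moreover have "\<forall>\<^sub>F t in at_right (0::real). 0 < t \<and> t \<le> 1"
    unfolding eventually_at_right_field by (intro exI[of _ 1]) auto
  ultimately have "\<forall>\<^sub>F t in at_right 0. 0 \<le> trace (D ** (S - matrix_inv (B t)))"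
  proof eventually_elim
    case (elim t)
    then have t: "0 < t" "t \<le> 1" and pd: "pos_def (B t)" by auto
    have "B t $ a $ b \<le> 0" if "a \<noteq> b" for a b
    proof -
      have "B t $ a $ b = (1 - t) * A $ a $ b + t * (A $ a $ b + D $ a $ b)"
        by (simp add: B_def algebra_simps)
      moreover have "(1 - t) * A $ a $ b \<le> 0"
        using A(1) t that by (intro mult_nonneg_nonpos) (auto simp: M_closed_def)
      moreover have "t * (A $ a $ b + D $ a $ b) \<le> 0"
        using D_sign[OF that] t by (intro mult_nonneg_nonpos) auto
      ultimately show ?thesis by simp
    qed
    then have "B t \<in> M_closed" using pd by (simp add: M_closed_def pos_def_imp_pos_semidef)
    moreover have "B t $ a $ b = A $ a $ b" if "a \<noteq> i" "b \<noteq> i" for a b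
      using D_block[OF that] by (simp add: B_def)
    ultimately have "B t \<in> block_slice A i" by (simp add: block_slice_def)
    then have "finite_objective S A \<le> finite_objective S (B t)" using pd by (rule opt)
    moreover have "finite_objective S (B t) + trace ((A - B t) ** (S - matrix_inv (B t)))
        \<le> finite_objective S A"
      by (rule finite_objective_tangent(1)[OF A(2) pd])
    moreover have "A - B t = (- t) *\<^sub>R D" by (simp add: B_def)
    then have "trace ((A - B t) ** (S - matrix_inv (B t))) = - t * trace (D ** (S - matrix_inv (B t)))"
      by (simp only: linear_scale[OF trace_mult_linear] real_scaleR_def)
    ultimately have "0 \<le> t * trace (D ** (S - matrix_inv (B t)))" by simp
    then show ?case using t by (simp add: zero_le_mult_iff)
  qed
  moreover have "((\<lambda>t. trace (D ** (S - matrix_inv (B t)))) \<longlongrightarrow> trace (D ** (S - matrix_inv A))) (at_right 0)"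
    unfolding trace_mult_entries
    using pos_def_det_pos[OF A(2)]
    by (intro tendsto_intros tendsto_matrix_inv lim) simp
  ultimately show ?thesis
    by (intro tendsto_lowerbound[where F = "at_right 0"]) auto
qed

text \<open>Let \<open>D i\<close> be row and column \<open>i\<close> of \<open>\<Omega> - A\<close>, with the diagonal entry doubled. The doubling is harmless
because diagonal entries carry no sign constraint, and it makes the \<open>D i\<close> sum up to
\<open>2 (\<Omega> - A)\<close>, every entry being counted once for its row and once for its column. So the
stationarity conditions add up to a nonnegative derivative towards \<open>\<Omega>\<close>, and convexity concludes.\<close>
lemma blockwise_optimal_imp_optimal:
  fixes S A \<Omega> :: "real^'n^'n"
  assumes A: "A \<in> M_closed" "pos_def A" and \<Omega>: "\<Omega> \<in> M_closed" "pos_def \<Omega>"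
    and opt: "\<And>i B. B \<in> block_slice A i \<Longrightarrow> pos_def B \<Longrightarrow> finite_objective S A \<le> finite_objective S B"
  shows "finite_objective S A \<le> finite_objective S \<Omega>"
proof -
  define E where "E = \<Omega> - A"
  define D :: "'n \<Rightarrow> real^'n^'n" where
    "D i = (\<chi> a b. (if a = i then E $ a $ b else 0) + (if b = i then E $ a $ b else 0))" for i
  have E_sym: "E $ a $ b = E $ b $ a" for a b
    using M_closed_symmetric[OF A(1), of a b] M_closed_symmetric[OF \<Omega>(1), of a b] by (simp add: E_def)
  have "0 \<le> trace (D i ** (S - matrix_inv A))" for i
  proof (rule block_optimal_imp_stationary[where i = i, OF A opt])
    show "transpose (D i) = D i"
      by (simp add: D_def transpose_def vec_eq_iff E_sym add.commute)
    show "A $ a $ b + D i $ a $ b \<le> 0" if "a \<noteq> b" for a b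
      using A(1) \<Omega>(1) that by (auto simp: D_def E_def M_closed_def)
  qed (simp_all add: D_def)
  then have "0 \<le> (\<Sum>i\<in>UNIV. trace (D i ** (S - matrix_inv A)))" by (simp add: sum_nonneg)
  also have "\<dots> = trace ((\<Sum>i\<in>UNIV. D i) ** (S - matrix_inv A))"
    by (rule linear_sum[OF trace_mult_linear, symmetric])
  also have "(\<Sum>i\<in>UNIV. D i) = 2 *\<^sub>R E"
    by (simp add: vec_eq_iff D_def sum.distrib)
  also have "trace ((2 *\<^sub>R E) ** (S - matrix_inv A)) = 2 * trace (E ** (S - matrix_inv A))"
    by (simp only: linear_scale[OF trace_mult_linear] real_scaleR_def)
  finally have "0 \<le> trace ((\<Omega> - A) ** (S - matrix_inv A))" by (simp add: E_def)
  then show ?thesis using finite_objective_tangent(1)[OF \<Omega>(2) A(2), of S] by simp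
qed

section \<open>Convergence of cyclic block minimization\<close>

text \<open>A uniform form of strict convexity: the midpoint gap is continuous and positive on the compact set
of pairs at distance at least \<open>e\<close>.\<close>
lemma objective_gap_on_sublevel:
  fixes S :: "real^'n^'n"
  assumes S: "coercive_on_M S" and "0 < e"
  obtains \<delta> where "0 < \<delta>" and "\<And>A B. A \<in> sublevel S c \<Longrightarrow> B \<in> sublevel S c \<Longrightarrow> e \<le> dist A B \<Longrightarrow>
    \<delta> \<le> finite_objective S A + finite_objective S B - 2 * finite_objective S (midpoint A B)"
proof -
  define G where "G = (\<lambda>(A, B). finite_objective S A + finite_objective S B
    - 2 * finite_objective S (midpoint A B))"
  define Q where "Q = (sublevel S c \<times> sublevel S c) \<inter> {x. e \<le> dist (fst x) (snd x)}"
  have "compact Q" unfolding Q_def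
    by (intro compact_Int_closed compact_Times compact_sublevel[OF S] closed_Collect_le continuous_intros)
  have pd: "pos_def A" if "A \<in> sublevel S c" for A using that by (simp add: sublevel_def)
  have "continuous_on Q G"
    unfolding continuous_on
  proof
    fix x assume "x \<in> Q"
    then have x: "e \<le> dist (fst x) (snd x)" "pos_def (fst x)" "pos_def (snd x)"
      using pd by (auto simp: Q_def)
    then have ne: "fst x \<noteq> snd x" using \<open>0 < e\<close> by auto
    have fst: "(fst \<longlongrightarrow> fst x) (at x within Q)" and snd: "(snd \<longlongrightarrow> snd x) (at x within Q)"
      by (intro tendsto_intros)+
    have mid: "((\<lambda>y. midpoint (fst y) (snd y)) \<longlongrightarrow> midpoint (fst x) (snd x)) (at x within Q)"
      unfolding midpoint_def by (intro tendsto_intros)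
    show "(G \<longlongrightarrow> G x) (at x within Q)"
      unfolding G_def case_prod_beta
      by (intro tendsto_intros tendsto_finite_objective fst snd mid x finite_objective_midpoint(1)[OF x(2,3) ne])
  qed
  have G_pos: "0 < G x" if "x \<in> Q" for x
  proof -
    have x: "e \<le> dist (fst x) (snd x)" "pos_def (fst x)" "pos_def (snd x)"
      using that pd by (auto simp: Q_def)
    then have "fst x \<noteq> snd x" using \<open>0 < e\<close> by auto
    then show ?thesis
      using finite_objective_midpoint(2)[OF x(2,3), of S] by (simp add: G_def case_prod_beta)
  qed
  obtain \<delta> where "0 < \<delta>" "\<And>x. x \<in> Q \<Longrightarrow> \<delta> \<le> G x"
  proof (cases "Q = {}")
    case True
    then show ?thesis using that[of 1] by simp
  next
    case False
    then obtain z where "z \<in> Q" "\<And>x. x \<in> Q \<Longrightarrow> G z \<le> G x"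
      using continuous_attains_inf[OF \<open>compact Q\<close> _ \<open>continuous_on Q G\<close>] by blast
    then show ?thesis using that[of "G z"] G_pos by blast
  qed
  then show thesis
    by (intro that[of \<delta>]) (fastforce simp: Q_def G_def)+
qed

text \<open>Every block occurs in each window of \<open>N\<close> consecutive steps. A limit point can therefore be compared
with a competitor in block \<open>i\<close> at the updates of that block: they are only boundedly many steps away
from the subsequence, and the steps tend to 0, so the iterates there have the same limit.\<close>
lemma cyclic_block_minimization_converges:
  fixes S :: "real^'n^'n" and X :: "nat \<Rightarrow> real^'n^'n" and j :: "nat \<Rightarrow> 'n"
  assumes S: "coercive_on_M S" and init: "X 0 \<in> M_closed" "pos_def (X 0)"
    and step: "\<And>t. X t \<in> M_closed \<Longrightarrow> pos_def (X t) \<Longrightarrow>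
        is_arg_min (objective S) (\<lambda>A. A \<in> block_slice (X t) (j t)) (X (Suc t))"
    and visits: "\<And>t i. \<exists>d<N. j (t + d) = i"
  shows "X \<longlonglongrightarrow> estimator S"
proof -
  define F where "F = finite_objective S"
  define K where "K = sublevel S (F (X 0))"
  have feasible: "X t \<in> M_closed \<and> pos_def (X t)" for t
  proof (induction t)
    case (Suc t)
    then have "is_arg_min (objective S) (\<lambda>A. A \<in> block_slice (X t) (j t)) (X (Suc t))"
      using step by blast
    then show ?case
      using is_arg_min_objective_iff[OF block_slice_self, of "X t" S "j t"] Suc
      by (auto simp: block_slice_def)
  qed (use init in simp)
  have next_block: "X (Suc t) \<in> block_slice (X t) (j t)"
    and next_min: "\<And>B. B \<in> block_slice (X t) (j t) \<Longrightarrow> pos_def B \<Longrightarrow> F (X (Suc t)) \<le> F B" for t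
    using step[of t] is_arg_min_objective_iff[OF block_slice_self, of "X t" S "j t"] feasible[of t]
    unfolding F_def by blast+
  have descent: "F (X (Suc t)) \<le> F (X t)" for t
    using next_min[OF block_slice_self] feasible by blast
  then have dec: "decseq (\<lambda>t. F (X t))" by (rule decseq_SucI)
  have in_K: "X t \<in> K" for t
    using decseqD[OF dec, of 0 t] feasible[of t] by (simp add: K_def sublevel_def F_def)
  have pd_K: "pos_def A" "A \<in> M_closed" if "A \<in> K" for A
    using that by (auto simp: K_def sublevel_def)
  have "compact K" unfolding K_def by (rule compact_sublevel[OF S])
  have est: "estimator S \<in> M_closed" "pos_def (estimator S)"
      "\<And>B. B \<in> M_closed \<Longrightarrow> pos_def B \<Longrightarrow> F (estimator S) \<le> F B"
    using estimator_is_arg_min(1)[OF S] is_arg_min_objective_iff[OF init] unfolding F_def by blast+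
  have "\<forall>t. F (estimator S) \<le> F (X t)" using est(3) feasible by blast
  then obtain L where L: "(\<lambda>t. F (X t)) \<longlonglongrightarrow> L"
    using decseq_convergent[OF dec] by blast
  have decrement: "(\<lambda>t. F (X t) - F (X (Suc t))) \<longlonglongrightarrow> 0"
    using tendsto_diff[OF L LIMSEQ_Suc[OF L]] by simp
  \<comment> \<open>Long steps are excluded eventually: the next iterate is at least as good as the midpoint of the step.\<close>
  have consecutive: "(\<lambda>t. dist (X (Suc t)) (X t)) \<longlonglongrightarrow> 0"
  proof (rule tendstoI)
    fix e :: real assume "0 < e"
    then obtain \<delta> where \<delta>: "0 < \<delta>" "\<And>A B. A \<in> K \<Longrightarrow> B \<in> K \<Longrightarrow> e \<le> dist A B \<Longrightarrow>
        \<delta> \<le> F A + F B - 2 * F (midpoint A B)"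
      using objective_gap_on_sublevel[OF S] unfolding K_def F_def by metis
    have "\<forall>\<^sub>F t in sequentially. F (X t) - F (X (Suc t)) < \<delta>"
      using order_tendstoD(2)[OF decrement \<delta>(1)] .
    then show "\<forall>\<^sub>F t in sequentially. dist (dist (X (Suc t)) (X t)) 0 < e"
    proof eventually_elim
      case (elim t)
      show ?case
      proof (rule ccontr)
        assume "\<not> ?thesis"
        then have far: "e \<le> dist (X t) (X (Suc t))" by (simp add: dist_commute)
        then have "X t \<noteq> X (Suc t)" using \<open>0 < e\<close> by auto
        then have "pos_def (midpoint (X t) (X (Suc t)))"
          using finite_objective_midpoint(1) feasible by blast
        moreover have "midpoint (X t) (X (Suc t)) \<in> block_slice (X t) (j t)"
          using closed_segment_subset[OF block_slice_self next_block convex_block_slice]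
            midpoint_in_closed_segment feasible by blast
        ultimately have "F (X (Suc t)) \<le> F (midpoint (X t) (X (Suc t)))" using next_min by blast
        then show False using \<delta>(2)[OF in_K in_K far] elim by simp
      qed
    qed
  qed
  \<comment> \<open>\<open>s t i\<close> is a time less than \<open>N\<close> steps after \<open>t\<close> at which block \<open>i\<close> is due to be updated.\<close>
  have "\<forall>t i. \<exists>s. t \<le> s \<and> s < t + N \<and> j s = i"
    by (metis visits le_add1 nat_add_left_cancel_less)
  then obtain s where s: "\<And>t i. t \<le> s t i" "\<And>t i. s t i < t + N" "\<And>t i. j (s t i) = i"
    by metis
  have within_cycle: "(\<lambda>t. dist (X (s t i)) (X t)) \<longlonglongrightarrow> 0" for i
  proof -
    have path: "dist (X (t + d)) (X t) \<le> (\<Sum>k<d. dist (X (Suc (t + k))) (X (t + k)))" for t d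
    proof (induction d)
      case (Suc d)
      then show ?case using dist_triangle[of "X (Suc (t + d))" "X t" "X (t + d)"] by simp
    qed simp
    have bound: "norm (dist (X (s t i)) (X t)) \<le> (\<Sum>k<N. dist (X (Suc (t + k))) (X (t + k)))" for t
    proof -
      have "dist (X (s t i)) (X t) \<le> (\<Sum>k<s t i - t. dist (X (Suc (t + k))) (X (t + k)))"
        using path[of t "s t i - t"] s(1)[of t i] by simp
      also have "\<dots> \<le> (\<Sum>k<N. dist (X (Suc (t + k))) (X (t + k)))"
        using s(2)[of t i] by (intro sum_mono2) auto
      finally show ?thesis by simp
    qed
    have "(\<lambda>t. \<Sum>k<N. dist (X (Suc (t + k))) (X (t + k))) \<longlonglongrightarrow> (\<Sum>k<N. 0)"
      by (intro tendsto_sum LIMSEQ_ignore_initial_segment[OF consecutive])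
    then have "(\<lambda>t. \<Sum>k<N. dist (X (Suc (t + k))) (X (t + k))) \<longlonglongrightarrow> 0" by (simp only: sum.neutral_const)
    with always_eventually[OF allI[OF bound]] show ?thesis by (rule Lim_null_comparison)
  qed
  have limit_point: "A = estimator S" if r: "strict_mono r" and lim: "(X \<circ> r) \<longlonglongrightarrow> A" and A: "A \<in> K" for r A
  proof -
    have block_opt: "F A \<le> F B" if B: "B \<in> block_slice A i" "pos_def B" for i B
    proof -
      define q where "q n = s (r n) i" for n
      have "(\<lambda>n. dist (X (q n)) (X (r n))) \<longlonglongrightarrow> 0"
        using LIMSEQ_subseq_LIMSEQ[OF within_cycle r] by (simp add: q_def o_def)
      then have Xq: "(\<lambda>n. X (q n)) \<longlonglongrightarrow> A"
        using lim by (intro Lim_transform[OF lim[unfolded o_def]]) (simp add: dist_norm tendsto_norm_zero_iff)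
      have "n \<le> q n" for n
        unfolding q_def using seq_suble[OF r, of n] s(1)[of "r n" i] by (rule order_trans)
      then have q_at_top: "filterlim q at_top sequentially"
        by (intro filterlim_at_top_mono[OF filterlim_ident] always_eventually allI)
      have "(\<lambda>n. dist (X (Suc (q n))) (X (q n))) \<longlonglongrightarrow> 0"
        using filterlim_compose[OF consecutive q_at_top] .
      then have XSq: "(\<lambda>n. X (Suc (q n))) \<longlonglongrightarrow> A"
        by (intro Lim_transform[OF Xq]) (simp add: dist_norm tendsto_norm_zero_iff)
      \<comment> \<open>Row and column \<open>i\<close> of the competitor \<open>B\<close> are inserted into the iterates. For large \<open>n\<close> the
        result is positive definite, hence feasible in step \<open>q n\<close>.\<close>
      define R where "R n = replace_row_col (X (q n)) i (B $ i)" for n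
      have "R \<longlonglongrightarrow> replace_row_col A i (B $ i)"
        unfolding R_def replace_row_col_def
        by (intro tendsto_vec_lambda) (auto intro!: tendsto_intros Xq)
      then have R: "R \<longlonglongrightarrow> B" using replace_row_col_own_row[OF B(1)] by simp
      have R_sym: "transpose (R n) = R n" for n
        using M_closed_symmetric feasible[of "q n"]
        by (auto simp: R_def replace_row_col_def transpose_def vec_eq_iff)
      have "\<forall>\<^sub>F n in sequentially. pos_def (R n)"
        using R_sym by (intro eventually_pos_def[OF R B(2)]) simp
      then have "\<forall>\<^sub>F n in sequentially. F (X (Suc (q n))) \<le> F (R n)"
      proof eventually_elim
        case (elim n)
        have "block_feasible (X (q n)) i (B $ i)"
          using B(1) pos_def_imp_pos_semidef[OF elim]
          by (auto simp: block_feasible_def R_def block_slice_def M_closed_def)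
        then have "R n \<in> block_slice (X (q n)) i"
          unfolding R_def using replace_row_col_in_block_slice feasible by blast
        then show ?case using next_min[of "R n" "q n"] elim s(3) by (simp add: q_def)
      qed
      with tendsto_finite_objective[OF R B(2), of S]
        tendsto_finite_objective[OF XSq pd_K(1)[OF A], of S]
      show ?thesis unfolding F_def by (rule tendsto_le[OF trivial_limit_sequentially])
    qed
    have "F A \<le> F \<Omega>" if "\<Omega> \<in> M_closed" "pos_def \<Omega>" for \<Omega>
      using blockwise_optimal_imp_optimal[OF pd_K(2)[OF A] pd_K(1)[OF A] that block_opt[unfolded F_def]]
      unfolding F_def .
    then have "is_arg_min (objective S) (\<lambda>\<Omega>. \<Omega> \<in> M_closed) A"
      using is_arg_min_objective_iff[OF init] pd_K[OF A] by (simp add: F_def)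
    then show ?thesis by (rule estimator_is_arg_min(2)[OF S])
  qed
  show ?thesis
  proof (rule tendstoI, rule ccontr)
    fix e :: real
    assume "0 < e" and "\<not> (\<forall>\<^sub>F t in sequentially. dist (X t) (estimator S) < e)"
    then have "infinite {t. e \<le> dist (X t) (estimator S)}"
      by (simp add: eventually_sequentially infinite_nat_iff_unbounded_le not_less)
    then obtain r1 :: "nat \<Rightarrow> nat" where r1: "strict_mono r1" "\<And>n. e \<le> dist (X (r1 n)) (estimator S)"
      using infinite_enumerate by blast
    obtain A r2 where A: "A \<in> K" "strict_mono r2" "((X \<circ> r1) \<circ> r2) \<longlonglongrightarrow> A"
      using \<open>compact K\<close> in_K unfolding compact_def by (metis comp_apply)
    then have "(X \<circ> (r1 \<circ> r2)) \<longlonglongrightarrow> A" by (simp add: o_assoc)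
    then have "A = estimator S"
      using limit_point[OF strict_mono_o[OF r1(1) A(2)]] A(1) by blast
    then have "\<forall>\<^sub>F n in sequentially. dist (X (r1 (r2 n))) (estimator S) < e"
      using tendstoD[OF A(3) \<open>0 < e\<close>] by simp
    then have "\<exists>n. dist (X (r1 (r2 n))) (estimator S) < e"
      by (rule eventually_happens'[OF sequentially_bot])
    then show False using r1(2) by (meson not_less)
  qed
qed

section \<open>The sample second moment matrix and the initial iterate\<close>

lemma sample_second_moment_entry:
  "sample_second_moment n x \<mu> $ j $ k = (\<Sum>i=1..n. (x i - \<mu>) $ j * (x i - \<mu>) $ k) / real n"
  by (simp add: sample_second_moment_def outer_prod_def sum_component)

text \<open>By Cauchy--Schwarz a correlation is at most 1, so that excluding the value 1 leaves a strict inequality.\<close>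
lemma sample_second_moment_le_sqrt:
  "sample_second_moment n x \<mu> $ j $ k
     \<le> sqrt (sample_second_moment n x \<mu> $ j $ j * sample_second_moment n x \<mu> $ k $ k)"
proof -
  define y where "y i a = (x i - \<mu>) $ a" for i a
  have "(\<Sum>i=1..n. y i j * y i k)\<^sup>2 \<le> (\<Sum>i=1..n. (y i j)\<^sup>2) * (\<Sum>i=1..n. (y i k)\<^sup>2)"
    by (rule Cauchy_Schwarz_ineq_sum)
  then have "((\<Sum>i=1..n. y i j * y i k) / real n)\<^sup>2
      \<le> ((\<Sum>i=1..n. (y i j)\<^sup>2) / real n) * ((\<Sum>i=1..n. (y i k)\<^sup>2) / real n)"
    by (simp add: power_divide power2_eq_square[of "real n"] divide_right_mono)
  then show ?thesis
    unfolding sample_second_moment_entry y_def power2_eq_square[of "_ $ _"] by (rule real_le_rsqrt)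
qed

lemma initial_iterate:
  fixes S :: "real^'n^'n"
  assumes "\<And>j. 0 < S $ j $ j"
  shows "pos_def (matrix_inv (diag_part S))" and "matrix_inv (diag_part S) \<in> M_closed"
proof -
  define P :: "real^'n^'n" where "P = (\<chi> j k. if j = k then 1 / S $ j $ j else 0)"
  have "S $ j $ j \<noteq> 0" for j using assms[of j] by simp
  then have "diag_part S $ a $ k * P $ k $ b = (if k = a then if a = b then 1 else 0 else 0)" for a b k
    by (simp add: diag_part_def P_def)
  then have "diag_part S ** P = mat 1"
    by (simp add: matrix_matrix_mult_def mat_def vec_eq_iff)
  then have inv: "matrix_inv (diag_part S) = P" by (rule matrix_inv_eqI)
  have "0 < v \<bullet> (P *v v)" if v: "v \<noteq> 0" for v
  proof -
    have "v \<bullet> (P *v v) = (\<Sum>j\<in>UNIV. (v $ j)\<^sup>2 / S $ j $ j)"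
      by (simp add: power2_eq_square inner_vec_def matrix_vector_mult_def P_def if_distrib[of "\<lambda>c. c * _"] cong: if_cong)
    moreover obtain i where "v $ i \<noteq> 0" using v by (auto simp: vec_eq_iff)
    then have "0 < (\<Sum>j\<in>UNIV. (v $ j)\<^sup>2 / S $ j $ j)"
      using assms by (intro sum_pos2[of _ i]) (auto simp: zero_less_divide_iff less_imp_le)
    ultimately show ?thesis by simp
  qed
  then have P: "pos_def P" by (simp add: pos_def_def P_def transpose_def vec_eq_iff)
  then show "pos_def (matrix_inv (diag_part S))" by (simp add: inv)
  show "matrix_inv (diag_part S) \<in> M_closed"
    using pos_def_imp_pos_semidef[OF P] unfolding inv by (simp add: M_closed_def P_def)
qed

lemma cyclic_order_visits:
  fixes idx :: "nat \<Rightarrow> 'p::finite"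
  assumes "bij_betw idx {..<CARD('p)} UNIV"
  shows "\<exists>d<CARD('p). idx ((t + d) mod CARD('p)) = i"
proof -
  let ?p = "CARD('p)"
  have "i \<in> idx ` {..<?p}" using assms by (simp add: bij_betw_def)
  then obtain m where m: "m < ?p" "idx m = i" by auto
  \<comment> \<open>The distance from the current position in the cycle to the position \<open>m\<close> of \<open>i\<close>, going forward.\<close>
  define d where "d = (m + (?p - t mod ?p)) mod ?p"
  have "t mod ?p < ?p" by simp
  have "(t + d) mod ?p = (t mod ?p + (m + (?p - t mod ?p))) mod ?p"
    unfolding d_def by (simp only: mod_add_right_eq mod_add_left_eq)
  also have "t mod ?p + (m + (?p - t mod ?p)) = m + ?p"
    using \<open>t mod ?p < ?p\<close> by linarith
  also have "(m + ?p) mod ?p = m" using m(1) by simp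
  finally show ?thesis using m(2) by (intro exI[of _ d]) (auto simp: d_def)
qed

theorem theorem3:
  fixes n :: nat
    and x :: "nat \<Rightarrow> real ^ 'p"
    and \<mu> :: "real ^ 'p"
    and S :: "real ^ 'p ^ 'p"
    and idx :: "nat \<Rightarrow> 'p"
  assumes S: "S = sample_second_moment n x \<mu>"
    and diag_pos: "\<forall>j. 0 < S $ j $ j"
    and no_pair: "\<not> (\<exists>j k. j \<noteq> k \<and> S $ j $ k = sqrt (S $ j $ j * S $ k $ k))"
    and idx: "bij_betw idx {..<CARD('p)} UNIV"
  shows "bcd_iterate idx S \<longlonglongrightarrow> estimator S"
proof -
  have "S $ j $ k < sqrt (S $ j $ j * S $ k $ k)" if "j \<noteq> k" for j k
    using sample_second_moment_le_sqrt[of n x \<mu> j k] no_pair that unfolding S by (metis less_le)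
  then have coercive: "coercive_on_M S"
    using diag_pos by (intro coercive_on_M_if_no_perfect_correlation) auto
  show ?thesis
  proof (rule cyclic_block_minimization_converges[OF coercive])
    show "bcd_iterate idx S 0 \<in> M_closed" "pos_def (bcd_iterate idx S 0)"
      using initial_iterate[of S] diag_pos by auto
    show "is_arg_min (objective S)
        (\<lambda>A. A \<in> block_slice (bcd_iterate idx S t) (idx (t mod CARD('p)))) (bcd_iterate idx S (Suc t))"
      if "bcd_iterate idx S t \<in> M_closed" "pos_def (bcd_iterate idx S t)" for t
      using block_step_is_arg_min[OF coercive that] by (simp add: Let_def)
    show "\<exists>d<CARD('p). idx ((t + d) mod CARD('p)) = i" for t i
      by (rule cyclic_order_visits[OF idx])
  qed
qed

end
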